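(* Define $\alpha(n)$ by $$\sum_{n\ge0}\alpha(n)q^n=\frac{(q,q^4;q^5)_\infty^2(-q^4,-q^6;q^{10})_\infty}{(q^2,q^3;q^5)_\infty^2(-q^2,-q^8;q^{10})_\infty}.$$ Let $E(q)=(q;q)_\infty$, $G(q)=\frac{1}{(q,q^4;q^5)_\infty}$, $H(q)=\frac{1}{(q^2,q^3;q^5)_\infty}$. Then $$\sum_{n\ge0}\alpha(5n+2)q^n=\frac{2G(q^2)^4H(q^2)^3E(q^{20})^2}{G(q^4)H(q^4)^2E(q^{10})^2}$$ and $$\sum_{n\ge0}\alpha(5n+3)q^n=-\frac{2qG(q^2)^3H(q^2)^4E(q^{20})^2}{G(q^4)^2H(q^4)E(q^{10})^2}.$$
   Context: $(A;q)_\infty=\prod_{k\ge0}(1-Aq^k)$, $(A_1,\dots,A_n;q)_\infty=\prod_i(A_i;q)_\infty$. $G,H$ are the Rogers–Ramanujan functions. *)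

theory Defs
  imports
    "HOL-Analysis.Analysis"
    "HOL-Computational_Algebra.Formal_Power_Series"
begin

text \<open>
  All identities are identities of formal power series in \<open>q = fps_X\<close> over the complex numbers.
  The infinite product is taken in the \<open>q\<close>-adic topology of the library; it converges whenever
  the constant coefficient of the base \<open>Q\<close> is 0. A \<open>q\<close>-series \<open>F(q)\<close> is a function of its
  argument, so that \<open>F(q^k)\<close> is \<open>F (fps_X ^ k)\<close>.
\<close>

definition qpoch :: "complex fps \<Rightarrow> complex fps \<Rightarrow> complex fps" where
  "qpoch A Q = (\<Prod>k. 1 - A * Q ^ k)"

definition qpochs :: "complex fps list \<Rightarrow> complex fps \<Rightarrow> complex fps" where
  "qpochs As Q = (\<Prod>A\<leftarrow>As. qpoch A Q)"

definition E_fun :: "complex fps \<Rightarrow> complex fps" where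
  "E_fun q = qpoch q q"

definition RR_G :: "complex fps \<Rightarrow> complex fps" where
  "RR_G q = 1 / qpochs [q, q ^ 4] (q ^ 5)"

definition RR_H :: "complex fps \<Rightarrow> complex fps" where
  "RR_H q = 1 / qpochs [q ^ 2, q ^ 3] (q ^ 5)"

end

theory Submission
  imports Defs "HOL-Computational_Algebra.Formal_Laurent_Series"
begin

text \<open>
  Write $E_n = (q^n;q^n)_\infty$ and let $f$ be the given product. Put
  $A = (q^4,q^8,q^{12},q^{16};q^{20})_\infty$ and $B = (q^2,q^6,q^{14},q^{18};q^{20})_\infty$.
  Splitting products of two theta series by parity gives
  $E_{10}^2 (q,q^9,-q^3,-q^7;q^{10})_\infty = E_{20}^2 (A - qB)$ and the same with
  $q \mapsto -q$. The product of the left-hand sides is $E_{10}^4 B$ and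
  $E_{10}^4 f B = E_{20}^4 (A - qB)^2$, hence
  $E_{10}^4 (f + 1) = 2 E_{20}^4 (A^2/B - qA) = 2 E_{20} E_{10} E_4 \psi(q^2) - 2 q E_{20}^3 E_4$,
  where $\psi(q) = \sum_{n \ge 0} q^{n(n+1)/2}$.
  The factors $E_{10}$ and $E_{20}$ are series in $q^5$. By the pentagonal number theorem $E_4$ has
  only exponents congruent to 0, 3, 4 modulo 5, so $q E_4$ has none congruent to 2 or 3. The
  exponents of $\psi(q^2)$ are congruent to 0, 1, 2, so each of the classes 2 and 3 of
  $E_4 \psi(q^2)$ is a single product of a class of $E_4$ and a class of $\psi(q^2)$; these are
  infinite products by the quintuple and the triple product identity.
\<close>

unbundle no vec_syntax and fps_syntax

section \<open>Sums of monomials over index sets\<close>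

text \<open>The formal sum of \<open>c i\<close> times q^(e i). Integer exponents allow quadratic
  expressions over all integers without conversions. A term of negative exponent is dropped and an
  infinite fibre would contribute 0; \<open>fsum_ok\<close> excludes both.\<close>

definition fsum :: "'i set \<Rightarrow> ('i \<Rightarrow> complex) \<Rightarrow> ('i \<Rightarrow> int) \<Rightarrow> complex fps" where
  "fsum A c e = Abs_fps (\<lambda>n. \<Sum>i | i \<in> A \<and> e i = int n. c i)"

text \<open>Finiteness is asked of sublevel sets: those of \<open>e i + e' j\<close> lie in products
  of sublevel sets of \<open>e\<close> and \<open>e'\<close>, so the condition passes to double
  sums.\<close>

definition fsum_ok :: "'i set \<Rightarrow> ('i \<Rightarrow> int) \<Rightarrow> bool" where
  "fsum_ok A e \<longleftrightarrow> (\<forall>i\<in>A. 0 \<le> e i) \<and> (\<forall>n. finite {i\<in>A. e i \<le> n})"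

lemma fsum_nth: "fsum A c e $ n = (\<Sum>i | i \<in> A \<and> e i = int n. c i)"
  by (simp add: fsum_def)

lemma fsum_ok_finite: "fsum_ok A e \<Longrightarrow> finite {i\<in>A. e i = n}"
  unfolding fsum_ok_def by (rule finite_subset[of _ "{i\<in>A. e i \<le> n}"]) auto

lemma fsum_ok_nonneg: "fsum_ok A e \<Longrightarrow> i \<in> A \<Longrightarrow> 0 \<le> e i"
  by (auto simp: fsum_ok_def)

lemma fsum_ok_subset: "fsum_ok A e \<Longrightarrow> B \<subseteq> A \<Longrightarrow> fsum_ok B e"
  unfolding fsum_ok_def
proof (intro conjI allI ballI)
  fix n assume *: "(\<forall>i\<in>A. 0 \<le> e i) \<and> (\<forall>n. finite {i \<in> A. e i \<le> n})" "B \<subseteq> A"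
  then show "finite {i \<in> B. e i \<le> n}"
    by (elim conjE allE[where x=n] finite_subset[rotated]) auto
qed auto

lemma fsum_ok_times:
  assumes "fsum_ok A e" "fsum_ok B e'"
  shows "fsum_ok (A \<times> B) (\<lambda>(i, j). e i + e' j)"
  unfolding fsum_ok_def
proof (intro conjI allI ballI)
  fix n
  have "{p \<in> A \<times> B. (case p of (i, j) \<Rightarrow> e i + e' j) \<le> n} \<subseteq> {i\<in>A. e i \<le> n} \<times> {i\<in>B. e' i \<le> n}"
    using assms[THEN fsum_ok_nonneg] by fastforce
  then show "finite {p \<in> A \<times> B. (case p of (i, j) \<Rightarrow> e i + e' j) \<le> n}"
    using assms unfolding fsum_ok_def by (meson finite_SigmaI finite_subset)
qed (use assms in \<open>auto simp: fsum_ok_def\<close>)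

text \<open>The pairs of total exponent \<open>n\<close> are sorted by the exponent \<open>m\<close>
  of the first factor, which lies in \<open>0..n\<close> because exponents are nonnegative; this is
  the Cauchy product.\<close>

lemma fsum_mult:
  assumes "fsum_ok A e" "fsum_ok B e'"
  shows "fsum A c e * fsum B c' e' =
    fsum (A \<times> B) (\<lambda>(i, j). c i * c' j) (\<lambda>(i, j). e i + e' j)"
proof (rule fps_ext)
  fix n
  let ?A = "\<lambda>k. {i\<in>A. e i = k}" and ?B = "\<lambda>k. {i\<in>B. e' i = k}"
  let ?C = "\<lambda>m. ?A (int m) \<times> ?B (int (n - m))"
  have fin: "finite (?A k)" "finite (?B k)" for k
    using assms by (auto intro: fsum_ok_finite)
  have "(fsum A c e * fsum B c' e') $ n = (\<Sum>m=0..n. sum c (?A (int m)) * sum c' (?B (int (n - m))))"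
    by (simp add: fps_mult_nth fsum_nth)
  also have "\<dots> = (\<Sum>m=0..n. \<Sum>p\<in>?C m. case p of (i, j) \<Rightarrow> c i * c' j)"
    by (simp add: sum_product sum.cartesian_product)
  also have "\<dots> = (\<Sum>p\<in>(\<Union>m\<in>{0..n}. ?C m). case p of (i, j) \<Rightarrow> c i * c' j)"
    by (subst sum.UNION_disjoint) (use fin in auto)
  also have "(\<Union>m\<in>{0..n}. ?C m) = {p \<in> A \<times> B. (case p of (i, j) \<Rightarrow> e i + e' j) = int n}"
  proof (intro set_eqI iffI)
    fix p assume p: "p \<in> {p \<in> A \<times> B. (case p of (i, j) \<Rightarrow> e i + e' j) = int n}"
    obtain i j where [simp]: "p = (i, j)" by force
    from p have ij: "i \<in> A" "j \<in> B" "e i + e' j = int n" by auto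
    with assms[THEN fsum_ok_nonneg] have "0 \<le> e i" "0 \<le> e' j" by auto
    with ij have "nat (e i) \<in> {0..n}" "p \<in> ?C (nat (e i))" by auto
    then show "p \<in> (\<Union>m\<in>{0..n}. ?C m)" by blast
  qed (auto simp: of_nat_diff)
  finally show "(fsum A c e * fsum B c' e') $ n =
    fsum (A \<times> B) (\<lambda>(i, j). c i * c' j) (\<lambda>(i, j). e i + e' j) $ n"
    by (simp add: fsum_nth)
qed

lemma fsum_reindex:
  assumes bij: "bij_betw g A B"
    and e: "\<And>i. i \<in> A \<Longrightarrow> e' (g i) = e i" and c: "\<And>i. i \<in> A \<Longrightarrow> c' (g i) = c i"
  shows "fsum A c e = fsum B c' e'"
proof (rule fps_ext)
  fix n
  have "bij_betw g {i\<in>A. e i = int n} {i\<in>B. e' i = int n}"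
    using bij e unfolding bij_betw_def inj_on_def by auto
  then have "(\<Sum>i | i \<in> A \<and> e i = int n. c' (g i)) = fsum B c' e' $ n"
    unfolding fsum_nth by (rule sum.reindex_bij_betw)
  then show "fsum A c e $ n = fsum B c' e' $ n"
    by (simp add: fsum_nth c)
qed

lemma fsum_Un:
  assumes "fsum_ok A e" "fsum_ok B e" "A \<inter> B = {}"
  shows "fsum (A \<union> B) c e = fsum A c e + fsum B c e"
proof (rule fps_ext)
  fix n
  have "{i \<in> A \<union> B. e i = int n} = {i \<in> A. e i = int n} \<union> {i \<in> B. e i = int n}" by auto
  then show "fsum (A \<union> B) c e $ n = (fsum A c e + fsum B c e) $ n"
    using assms(3) fsum_ok_finite[OF assms(1)] fsum_ok_finite[OF assms(2)]
    by (simp add: fsum_nth) (subst sum.union_disjoint; auto)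
qed

lemma fsum_split:
  assumes "fsum_ok A e"
  shows "fsum A c e = fsum {i\<in>A. P i} c e + fsum {i\<in>A. \<not> P i} c e"
proof -
  have "A = {i\<in>A. P i} \<union> {i\<in>A. \<not> P i}" by auto
  then have "fsum A c e = fsum ({i\<in>A. P i} \<union> {i\<in>A. \<not> P i}) c e" by simp
  also have "\<dots> = fsum {i\<in>A. P i} c e + fsum {i\<in>A. \<not> P i} c e"
    by (intro fsum_Un fsum_ok_subset[OF assms]) auto
  finally show ?thesis .
qed

lemma fsum_X_power_mult:
  assumes "fsum_ok A e"
  shows "fps_X ^ k * fsum A c e = fsum A c (\<lambda>i. int k + e i)"
proof (rule fps_ext)
  fix n
  have "{i\<in>A. int k + e i = int n} = (if n < k then {} else {i\<in>A. e i = int (n - k)})"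
    using fsum_ok_nonneg[OF assms] by (force simp: of_nat_diff)
  then show "(fps_X ^ k * fsum A c e) $ n = fsum A c (\<lambda>i. int k + e i) $ n"
    by (simp add: fps_X_power_mult_nth fsum_nth)
qed

lemma fsum_cmult: "fps_const a * fsum A c e = fsum A (\<lambda>i. a * c i) e"
  by (rule fps_ext) (simp add: fsum_nth sum_distrib_left)

lemma fsum_uminus: "- fsum A c e = fsum A (\<lambda>i. - c i) e"
  by (rule fps_ext) (simp add: fsum_nth sum_negf)

section \<open>Two-sided theta series\<close>

definition sgn_pow :: "complex \<Rightarrow> int \<Rightarrow> complex" where
  "sgn_pow s k = (if even k then 1 else s)"

text \<open>With \<open>sgn_pow s k\<close> in the role of s^k for s = 1 or s = -1, this is the
  series side of Jacobi's triple product. E_4 appears later as \<open>theta (-1) 6 (-2)\<close> and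
  psi(q^2) as \<open>theta 1 4 2\<close>.\<close>

definition theta :: "complex \<Rightarrow> int \<Rightarrow> int \<Rightarrow> complex fps" where
  "theta s d c = fsum UNIV (sgn_pow s) (\<lambda>k. d * k\<^sup>2 + c * k)"

text \<open>The right side is at least |k| (d |k| - |c|), whose second factor is at least 1 for
  nonzero k. The bound makes theta series well defined and limits the indices that reach a given
  coefficient.\<close>

lemma quadratic_ge_abs:
  fixes d c k :: int
  assumes "\<bar>c\<bar> < d"
  shows "\<bar>k\<bar> \<le> d * k\<^sup>2 + c * k"
proof (cases "k = 0")
  case False
  have "\<bar>k\<bar> * 1 \<le> \<bar>k\<bar> * (d * \<bar>k\<bar> - \<bar>c\<bar>)"
  proof (rule mult_left_mono)
    have "d * 1 \<le> d * \<bar>k\<bar>" using False assms by (intro mult_left_mono) auto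
    then show "1 \<le> d * \<bar>k\<bar> - \<bar>c\<bar>" using assms by linarith
  qed auto
  also have "\<dots> = d * k\<^sup>2 - \<bar>c * k\<bar>"
    by (simp add: algebra_simps abs_mult power2_eq_square)
  also have "\<dots> \<le> d * k\<^sup>2 + c * k" by linarith
  finally show ?thesis by simp
qed auto

lemma fsum_ok_quadratic:
  assumes "\<And>k. \<bar>k\<bar> \<le> e k + (N::int)" "\<And>k. 0 \<le> e k"
  shows "fsum_ok UNIV e"
  unfolding fsum_ok_def
proof (intro conjI allI ballI)
  fix n
  have "{i \<in> UNIV. e i \<le> n} \<subseteq> {-(n+N)..n+N}"
  proof
    fix i assume "i \<in> {i \<in> UNIV. e i \<le> n}"
    then show "i \<in> {-(n+N)..n+N}" using assms(1)[of i] by auto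
  qed
  then show "finite {i \<in> UNIV. e i \<le> n}" using finite_subset by blast
qed (rule assms(2))

lemma theta_ok:
  assumes "\<bar>c\<bar> < d"
  shows "fsum_ok UNIV (\<lambda>k. d * k\<^sup>2 + c * k)"
proof (rule fsum_ok_quadratic[where N=0])
  fix k
  show "\<bar>k\<bar> \<le> d * k\<^sup>2 + c * k + 0" using quadratic_ge_abs[OF assms, of k] by simp
  show "0 \<le> d * k\<^sup>2 + c * k" using quadratic_ge_abs[OF assms, of k] abs_ge_zero[of k] by linarith
qed

section \<open>Infinite products\<close>

text \<open>Congruence modulo q^(n+1).\<close>

definition trunc_eq :: "nat \<Rightarrow> complex fps \<Rightarrow> complex fps \<Rightarrow> bool" where
  "trunc_eq n F G \<longleftrightarrow> (\<forall>i\<le>n. F $ i = G $ i)"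

lemma trunc_eq_refl [simp]: "trunc_eq n F F"
  by (simp add: trunc_eq_def)

lemma trunc_eq_sym: "trunc_eq n F G \<Longrightarrow> trunc_eq n G F"
  by (simp add: trunc_eq_def)

lemma trunc_eq_trans [trans]: "trunc_eq n F G \<Longrightarrow> trunc_eq n G H \<Longrightarrow> trunc_eq n F H"
  by (simp add: trunc_eq_def)

lemma trunc_eq_mult: "trunc_eq n F G \<Longrightarrow> trunc_eq n F' G' \<Longrightarrow> trunc_eq n (F * F') (G * G')"
  by (auto simp: trunc_eq_def fps_mult_nth intro!: sum.cong)

lemma trunc_eq_prod: "(\<And>i. i \<in> A \<Longrightarrow> trunc_eq n (F i) (G i)) \<Longrightarrow> trunc_eq n (prod F A) (prod G A)"
  by (induction A rule: infinite_finite_induct) (auto intro: trunc_eq_mult)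

lemma fps_eq_trunc: "(\<And>n. trunc_eq n F G) \<Longrightarrow> F = G"
  by (rule fps_ext) (auto simp: trunc_eq_def)

text \<open>The finite product (A;Q)_n.\<close>

definition qpart :: "complex fps \<Rightarrow> complex fps \<Rightarrow> nat \<Rightarrow> complex fps" where
  "qpart A Q n = (\<Prod>k<n. 1 - A * Q ^ k)"

text \<open>A factor of index k > n is 1 modulo q^(n+1), because Q^k already has order greater than
  n.\<close>

lemma qpart_stable:
  assumes "A $ 0 = 0" "Q $ 0 = 0" "n < N"
  shows "trunc_eq n (qpart A Q N) (qpart A Q (Suc n))"
  using \<open>n < N\<close>
proof (induction N)
  case (Suc N)
  show ?case
  proof (cases "n = N")
    case False
    with Suc.prems have "n < N" by simp
    have z: "(A * Q ^ N) $ i = 0" if "i \<le> n" for i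
    proof -
      have "(Q ^ N) $ j = 0" if "j < N" for j
        using assms(2) that by (metis startsby_zero_power_prefix)
      then show ?thesis
        using that \<open>n < N\<close> by (simp add: fps_mult_nth)
    qed
    have "trunc_eq n (1 - A * Q ^ N) 1"
      by (simp add: trunc_eq_def z)
    then have "trunc_eq n (qpart A Q N * (1 - A * Q ^ N)) (qpart A Q (Suc n) * 1)"
      using Suc.IH[OF \<open>n < N\<close>] by (intro trunc_eq_mult)
    then show ?thesis by (simp add: qpart_def)
  qed auto
qed auto

text \<open>This links the topological infinite product to finite computations: each coefficient of
  the partial products is eventually constant, so they tend to the series \<open>P\<close> of stable
  coefficients.\<close>

lemma qpoch_trunc:
  assumes "A $ 0 = 0" "Q $ 0 = 0" "n < N"
  shows "trunc_eq n (qpoch A Q) (qpart A Q N)"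
proof -
  define P where "P = Abs_fps (\<lambda>n. qpart A Q (Suc n) $ n)"
  have P: "P $ n = qpart A Q N $ n" if "n < N" for n N
    using qpart_stable[OF assms(1,2) that] by (simp add: P_def trunc_eq_def)
  have "(\<lambda>n. \<Prod>k\<le>n. 1 - A * Q ^ k) \<longlonglongrightarrow> P"
  proof (rule tendsto_fpsI)
    fix n
    show "\<forall>\<^sub>F m in sequentially. (\<Prod>k\<le>m. 1 - A * Q ^ k) $ n = P $ n"
      using eventually_ge_at_top[of n]
    proof eventually_elim
      case (elim m)
      then show ?case
        using P[of n "Suc m"] by (simp add: qpart_def lessThan_Suc_atMost)
    qed
  qed
  \<comment> \<open>\<open>has_prod\<close> also requires the limit to be nonzero.\<close>
  moreover have "P $ 0 = 1" using P[of 0 1] assms by (simp add: qpart_def)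
  then have "P \<noteq> 0" by auto
  ultimately have "(\<lambda>k. 1 - A * Q ^ k) has_prod P"
    by (simp add: has_prod_def raw_has_prod_def)
  then have "qpoch A Q = P"
    using has_prod_unique by (auto simp: qpoch_def)
  then show ?thesis using P assms(3) by (simp add: trunc_eq_def)
qed

lemma qpoch_nth_0 [simp]:
  assumes "A $ 0 = 0" "Q $ 0 = 0"
  shows "qpoch A Q $ 0 = 1"
  using qpoch_trunc[OF assms, of 0 1] assms by (simp add: trunc_eq_def qpart_def)

lemma qpoch_nonzero:
  assumes "A $ 0 = 0" "Q $ 0 = 0"
  shows "qpoch A Q \<noteq> 0"
  using qpoch_nth_0[OF assms] by auto

text \<open>The factors are sorted by the residue of their index modulo \<open>m\<close>, first in
  partial products of \<open>m * N\<close> factors.\<close>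

lemma qpoch_split:
  assumes A: "A $ 0 = 0" and Q: "Q $ 0 = 0" and m: "m > 0"
  shows "qpoch A Q = (\<Prod>i<m. qpoch (A * Q ^ i) (Q ^ m))"
proof (rule fps_eq_trunc)
  fix n
  have "qpart A Q (m * N) = (\<Prod>i<m. qpart (A * Q ^ i) (Q ^ m) N)" for N
  proof -
    have "(\<Prod>i<m. qpart (A * Q ^ i) (Q ^ m) N) = (\<Prod>j<N. \<Prod>i<m. 1 - A * Q ^ (i + m * j))"
      unfolding qpart_def by (subst prod.swap) (simp add: power_add power_mult mult.assoc)
    also have "\<dots> = qpart A Q (m * N)"
    proof (induction N)
      case (Suc N)
      have "(\<Prod>i<m. 1 - A * Q ^ (i + m * N)) = (\<Prod>i\<in>{m * N..<m * N + m}. 1 - A * Q ^ i)"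
        using prod.shift_bounds_nat_ivl[of "\<lambda>i. 1 - A * Q ^ i" 0 "m * N" m]
        by (simp add: atLeast0LessThan add.commute)
      moreover have "{..<m * Suc N} = {..<m * N} \<union> {m * N..<m * N + m}" by auto
      ultimately show ?case
        using Suc.IH by (simp add: qpart_def prod.union_disjoint ivl_disj_int)
    qed (simp add: qpart_def)
    finally show ?thesis ..
  qed
  note * = this
  have "trunc_eq n (qpoch A Q) (qpart A Q (m * Suc n))"
    using m by (intro qpoch_trunc A Q) (cases m; simp)
  also have "trunc_eq n \<dots> (\<Prod>i<m. qpoch (A * Q ^ i) (Q ^ m))"
    unfolding * using A Q m by (intro trunc_eq_prod trunc_eq_sym[OF qpoch_trunc]) (auto simp: fps_power_zeroth)
  finally show "trunc_eq n (qpoch A Q) (\<Prod>i<m. qpoch (A * Q ^ i) (Q ^ m))" .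
qed

lemma qpoch_mult_uminus:
  assumes A: "A $ 0 = 0" and Q: "Q $ 0 = 0"
  shows "qpoch A Q * qpoch (- A) Q = qpoch (A ^ 2) (Q ^ 2)"
proof (rule fps_eq_trunc)
  fix n
  have *: "qpart A Q N * qpart (- A) Q N = qpart (A ^ 2) (Q ^ 2) N" for N
  proof -
    have "(1 - A * Q ^ k) * (1 - (- A) * Q ^ k) = 1 - A ^ 2 * (Q ^ 2) ^ k" for k
      by (simp add: algebra_simps power2_eq_square power_mult_distrib)
    then show ?thesis by (simp add: qpart_def flip: prod.distrib)
  qed
  have "trunc_eq n (qpoch A Q * qpoch (- A) Q) (qpart A Q (Suc n) * qpart (- A) Q (Suc n))"
    using A Q by (intro trunc_eq_mult qpoch_trunc) auto
  also have "trunc_eq n \<dots> (qpoch (A ^ 2) (Q ^ 2))"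
    unfolding * using A Q by (intro trunc_eq_sym[OF qpoch_trunc]) (auto simp: power2_eq_square)
  finally show "trunc_eq n (qpoch A Q * qpoch (- A) Q) (qpoch (A ^ 2) (Q ^ 2))" .
qed

section \<open>The Jacobi triple product\<close>

text \<open>Gaussian binomial coefficients through one of their Pascal rules, which avoids division
  and makes sense in every commutative ring.\<close>

fun qbinomial :: "'a::comm_ring_1 \<Rightarrow> nat \<Rightarrow> nat \<Rightarrow> 'a" where
  "qbinomial Q n 0 = 1"
| "qbinomial Q 0 (Suc k) = 0"
| "qbinomial Q (Suc n) (Suc k) = Q ^ Suc k * qbinomial Q n (Suc k) + qbinomial Q n k"

lemma qbinomial_eq_0: "n < k \<Longrightarrow> qbinomial Q n k = 0"
  by (induction Q n k rule: qbinomial.induct) auto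

text \<open>The quotient formula (Q;Q)_n / ((Q;Q)_k (Q;Q)_j), n = k + j, with denominators cleared.
  Inserted in Pascal's rule it leaves Q^k (1 - Q^j) + (1 - Q^k) = 1 - Q^(k+j).\<close>

lemma qbinomial_closed:
  fixes Q :: "'a::comm_ring_1"
  defines "P \<equiv> \<lambda>n. \<Prod>i<n. 1 - Q ^ Suc i"
  shows "qbinomial Q (k + j) k * (P k * P j) = P (k + j)"
proof (induction "k + j" arbitrary: k j)
  case 0
  then show ?case by (simp add: P_def)
next
  case (Suc n)
  have P_Suc: "P (Suc m) = P m * (1 - Q ^ Suc m)" for m by (simp add: P_def)
  show ?case
  proof (cases k)
    case 0
    then show ?thesis by (simp add: P_def)
  next
    case k: (Suc k')
    have n: "n = k' + j" using Suc.hyps k by simp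
    have 2: "qbinomial Q n k' * (P k' * P j) = P n"
      using Suc.hyps(1)[of k' j] n by simp
    show ?thesis
    proof (cases j)
      case 0
      with n have "qbinomial Q n k = 0" by (simp add: k qbinomial_eq_0)
      then have "qbinomial Q (k + j) k * (P k * P j) = qbinomial Q n k' * (P k' * P j) * (1 - Q ^ k)"
        using 0 n k by (simp add: P_Suc mult_ac)
      also have "\<dots> = P (k + j)"
        unfolding 2 using 0 n k P_Suc[of k'] by simp
      finally show ?thesis .
    next
      case j: (Suc j')
      have "n = k + j'" using n k j by simp
      then have 1: "qbinomial Q n k * (P k * P j') = P n"
        using Suc.hyps(1)[of k j'] by simp
      have "qbinomial Q (k + j) k * (P k * P j) =
        Q ^ k * (qbinomial Q n k * (P k * P j')) * (1 - Q ^ j) + qbinomial Q n k' * (P k' * P j) * (1 - Q ^ k)"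
        using n by (simp add: k j P_Suc algebra_simps)
      also have "\<dots> = P n * (1 - Q ^ (k + j))"
        unfolding 1 2 by (simp add: algebra_simps power_add)
      also have "\<dots> = P (k + j)"
        using n k P_Suc[of n] by simp
      finally show ?thesis .
    qed
  qed
qed

lemma choose_two_Suc: "Suc k * (Suc k - 1) div 2 = k * (k - 1) div 2 + k"
  by (cases k) auto

text \<open>Splitting off the factor k = 0 leaves the product of length n with y Q in place of y,
  hence the induction over arbitrary y. The homogeneous form permits a power of Q as x.\<close>

lemma qbinomial_theorem:
  fixes x y Q :: "'a::comm_ring_1"
  shows "(\<Prod>k<n. x + y * Q ^ k) =
    (\<Sum>k\<le>n. qbinomial Q n k * Q ^ (k * (k - 1) div 2) * x ^ (n - k) * y ^ k)"
proof (induction n arbitrary: y)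
  case (Suc n)
  let ?t = "\<lambda>k. k * (k - 1) div 2"
  let ?f = "\<lambda>k. qbinomial Q n k * Q ^ ?t k * x ^ (n - k) * y ^ k * Q ^ k"
  have "(\<Prod>k<Suc n. x + y * Q ^ k) = (x + y) * (\<Prod>k<n. x + (y * Q) * Q ^ k)"
    by (subst prod.lessThan_Suc_shift) (simp add: mult.assoc)
  also have "\<dots> = (x + y) * (\<Sum>k\<le>n. ?f k)"
    by (subst Suc.IH) (simp add: power_mult_distrib mult.assoc)
  \<comment> \<open>The added term at \<open>Suc n\<close> is zero; it lets the first sum, shifted
    by one, run over the same range as the second.\<close>
  also have "\<dots> = x * (\<Sum>k\<le>Suc n. ?f k) + y * (\<Sum>k\<le>n. ?f k)"
    by (simp add: distrib_right qbinomial_eq_0)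
  also have "x * (\<Sum>k\<le>Suc n. ?f k) = x ^ Suc n + (\<Sum>k\<le>n. x * ?f (Suc k))"
    by (subst sum.atMost_Suc_shift) (simp add: distrib_left sum_distrib_left)
  also have "x ^ Suc n + (\<Sum>k\<le>n. x * ?f (Suc k)) + y * (\<Sum>k\<le>n. ?f k) =
    x ^ Suc n + (\<Sum>k\<le>n. x * ?f (Suc k) + y * ?f k)"
    by (simp add: sum.distrib sum_distrib_left)
  also have "(\<Sum>k\<le>n. x * ?f (Suc k) + y * ?f k) =
    (\<Sum>k\<le>n. qbinomial Q (Suc n) (Suc k) * Q ^ ?t (Suc k) * x ^ (Suc n - Suc k) * y ^ Suc k)"
  proof (rule sum.cong)
    fix k assume "k \<in> {..n}"
    show "x * ?f (Suc k) + y * ?f k =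
      qbinomial Q (Suc n) (Suc k) * Q ^ ?t (Suc k) * x ^ (Suc n - Suc k) * y ^ Suc k"
    proof (cases "k = n")
      case True
      then show ?thesis
        unfolding choose_two_Suc by (simp add: qbinomial_eq_0 power_add algebra_simps)
    next
      case False
      with \<open>k \<in> {..n}\<close> have "n - k = Suc (n - Suc k)" by auto
      then show ?thesis
        unfolding choose_two_Suc
        by (simp add: power_add algebra_simps)
    qed
  qed auto
  also have "x ^ Suc n + \<dots> = (\<Sum>k\<le>Suc n. qbinomial Q (Suc n) k * Q ^ ?t k * x ^ (Suc n - k) * y ^ k)"
    by (subst sum.atMost_Suc_shift) simp
  finally show ?case .
qed simp

text \<open>The q-binomial theorem with 2n factors, x = Q^n and y = S q^a. Taking S q^a Q^k out of
  the first n factors leaves those with q^b in reverse order; taking Q^n out of the last n leaves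
  those with q^a.\<close>

lemma jacobi_finite:
  fixes s :: complex and a b n :: nat and d :: int
  assumes s: "s * s = 1" and ab: "int a + int b = 2 * d"
  defines "S \<equiv> fps_const s" and "Q \<equiv> (fps_X :: complex fps) ^ (a + b)"
  shows "(\<Prod>k<n. 1 + S * fps_X ^ a * Q ^ k) * (\<Prod>k<n. 1 + S * fps_X ^ b * Q ^ k) =
    (\<Sum>j\<le>2*n. fps_const (s ^ (n + j)) * qbinomial Q (2 * n) j *
       fps_X ^ nat (d * (int j - int n)\<^sup>2 + (int a - d) * (int j - int n)))"
    (is "?L = ?R")
proof -
  let ?X = "fps_X :: complex fps"
  let ?t = "\<lambda>k. k * (k - 1) div 2 :: nat"
  let ?e = "\<lambda>j. d * (int j - int n)\<^sup>2 + (int a - d) * (int j - int n)"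
  \<comment> \<open>The total power of q taken out of the 2n factors.\<close>
  define M where "M = a * n + (a + b) * (?t n + n * n)"
  have SS: "S * S = 1" using s by (simp add: S_def)
  have XX: "?X ^ a * ?X ^ b = Q" by (simp add: Q_def power_add)
  have t2: "2 * int (?t k) = int k * (int k - 1)" for k
  proof -
    have "even (k * (k - 1))" by (cases k) auto
    then have "2 * ?t k = k * (k - 1)" by (rule dvd_mult_div_cancel)
    then have "2 * int (?t k) = int (k * (k - 1))" by linarith
    also have "\<dots> = int k * (int k - 1)" by (cases k) (auto simp: algebra_simps)
    finally show ?thesis .
  qed
  have tsum: "(\<Prod>k<n. Q ^ k) = Q ^ ?t n"
  proof (induction n)
    case (Suc n)
    then show ?case unfolding choose_two_Suc by (simp add: power_add)
  qed simp
  have "(\<Prod>k<2*n. Q ^ n + S * ?X ^ a * Q ^ k) =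
    (\<Prod>k<n. Q ^ n + S * ?X ^ a * Q ^ k) * (\<Prod>k<n. Q ^ n + S * ?X ^ a * Q ^ (n + k))"
    using prod.lessThan_Suc_shift prod.nat_group[of "\<lambda>k. Q ^ n + S * ?X ^ a * Q ^ k" n 2]
    by (simp add: numeral_2_eq_2 prod.lessThan_Suc lessThan_Suc mult.commute
         prod.atLeastLessThan_shift_0[of _ n] atLeast0LessThan add.commute)
  also have "(\<Prod>k<n. Q ^ n + S * ?X ^ a * Q ^ k) =
    (\<Prod>k<n. S * ?X ^ a * Q ^ k * (1 + S * ?X ^ b * Q ^ (n - Suc k)))"
  proof (rule prod.cong)
    fix k assume "k \<in> {..<n}"
    then have "n = k + (1 + (n - Suc k))" by auto
    then have "Q ^ n = Q ^ (k + (1 + (n - Suc k)))" by (rule arg_cong)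
    then have "Q ^ n = Q ^ k * Q * Q ^ (n - Suc k)"
      by (simp only: power_add power_one_right mult.assoc)
    then have "Q ^ n = S * S * (?X ^ a * ?X ^ b) * Q ^ k * Q ^ (n - Suc k)"
      by (simp add: SS XX algebra_simps)
    then show "Q ^ n + S * ?X ^ a * Q ^ k = S * ?X ^ a * Q ^ k * (1 + S * ?X ^ b * Q ^ (n - Suc k))"
      by (simp add: algebra_simps)
  qed auto
  also have "\<dots> = S ^ n * ?X ^ (a * n) * Q ^ ?t n * (\<Prod>k<n. 1 + S * ?X ^ b * Q ^ k)"
    using prod.nat_diff_reindex[of "\<lambda>k. 1 + S * ?X ^ b * Q ^ k" n]
    by (simp add: prod.distrib tsum power_mult_distrib power_mult)
  also have "(\<Prod>k<n. Q ^ n + S * ?X ^ a * Q ^ (n + k)) = Q ^ (n * n) * (\<Prod>k<n. 1 + S * ?X ^ a * Q ^ k)"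
  proof -
    have "Q ^ n + S * ?X ^ a * Q ^ (n + k) = Q ^ n * (1 + S * ?X ^ a * Q ^ k)" for k
      by (simp add: algebra_simps power_add)
    then show ?thesis by (simp add: prod.distrib power_mult)
  qed
  finally have 1: "(\<Prod>k<2*n. Q ^ n + S * ?X ^ a * Q ^ k) = S ^ n * ?X ^ M * ?L"
    by (simp add: M_def power_add Q_def algebra_simps flip: power_mult)
  have "(\<Prod>k<2*n. Q ^ n + S * ?X ^ a * Q ^ k) =
    (\<Sum>j\<le>2*n. qbinomial Q (2*n) j * Q ^ ?t j * (Q ^ n) ^ (2*n - j) * (S * ?X ^ a) ^ j)"
    by (rule qbinomial_theorem)
  also have "\<dots> = (\<Sum>j\<le>2*n. ?X ^ M * (fps_const (s ^ j) * qbinomial Q (2*n) j * ?X ^ nat (?e j)))"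
  proof (rule sum.cong)
    fix j assume "j \<in> {..2*n}"
    then have j: "int (2 * n - j) = 2 * int n - int j" by auto
    have eq: "d * (int j - int n)\<^sup>2 + (int a - d) * (int j - int n) + int M
      = int ((a + b) * ?t j + (a + b) * n * (2 * n - j) + a * j)"
    proof -
      have "int M = int a * int n + d * (2 * int (?t n)) + 2 * d * int n * int n"
        unfolding M_def using ab by (simp only: of_nat_add of_nat_mult) (simp add: algebra_simps)
      moreover have "int ((a + b) * ?t j + (a + b) * n * (2 * n - j) + a * j)
        = d * (2 * int (?t j)) + 2 * d * int n * (2 * int n - int j) + int a * int j"
        using ab by (simp only: of_nat_add of_nat_mult j)
      ultimately show ?thesis
        unfolding t2 by (simp add: algebra_simps power2_eq_square)
    qed
    \<comment> \<open>This makes \<open>nat\<close> harmless in the exponent. Twice the exponent is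
      a i(i+1) + b i(i-1) with i = j - n, and products of consecutive integers are
      nonnegative.\<close>
    have "0 \<le> ?e j"
    proof -
      have "2 * ?e j = int a * ((int j - int n) * (int j - int n + 1))
         + int b * ((int j - int n) * (int j - int n - 1))"
      proof -
        have b: "int b = 2 * d - int a" using ab by simp
        show ?thesis unfolding b by (simp add: algebra_simps power2_eq_square)
      qed
      moreover have "0 \<le> i * (i + 1)" "0 \<le> i * (i - 1)" for i :: int
        by (cases "0 \<le> i"; cases "i = 0"; auto simp: mult_nonpos_nonpos zero_le_mult_iff)+
      ultimately show ?thesis
        by (metis add_nonneg_nonneg mult_nonneg_nonneg of_nat_0_le_iff zero_le_mult_iff zero_less_numeral
            order_less_le linorder_not_le)
    qed
    with eq have "nat (?e j) + M = (a + b) * ?t j + (a + b) * n * (2 * n - j) + a * j"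
      by linarith
    then have "?X ^ M * ?X ^ nat (?e j) = Q ^ ?t j * (Q ^ n) ^ (2 * n - j) * (?X ^ a) ^ j"
      unfolding Q_def by (simp add: mult.assoc flip: power_add power_mult)
    then show "qbinomial Q (2*n) j * Q ^ ?t j * (Q ^ n) ^ (2*n - j) * (S * ?X ^ a) ^ j =
      ?X ^ M * (fps_const (s ^ j) * qbinomial Q (2*n) j * ?X ^ nat (?e j))"
      by (simp add: power_mult_distrib S_def fps_const_power mult.commute mult.left_commute)
  qed auto
  finally have "?X ^ M * (S ^ n * ?L) = ?X ^ M * (\<Sum>j\<le>2*n. fps_const (s ^ j) * qbinomial Q (2*n) j * ?X ^ nat (?e j))"
    unfolding 1 by (simp add: sum_distrib_left mult.assoc mult.left_commute)
  then have "S ^ n * ?L = (\<Sum>j\<le>2*n. fps_const (s ^ j) * qbinomial Q (2*n) j * ?X ^ nat (?e j))"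
    by simp
  \<comment> \<open>Since S^n is its own inverse, multiplying by it moves the sign to the other side
    and turns s^j into s^(n+j).\<close>
  then have "S ^ n * (S ^ n * ?L) = ?R"
    by (simp add: sum_distrib_left S_def fps_const_power power_add mult.assoc flip: fps_const_mult)
  moreover have "S ^ n * (S ^ n * F) = F" for F
    using SS by (simp flip: mult.assoc power_mult_distrib)
  ultimately show ?thesis by (simp only:)
qed


text \<open>The partial sums of the finite identity stabilise because
  $(Q;Q)_m \equiv (Q;Q)_\infty$ for large $m$, so that
  $(Q;Q)_\infty$ times the q-binomial coefficients tends to 1.\<close>

theorem jacobi_triple_product:
  fixes s :: complex and a b :: nat and d c :: int
  assumes s: "s * s = 1" and a: "int a = d + c" and b: "int b = d - c" and pos: "a > 0" "b > 0"
  defines "Q \<equiv> (fps_X :: complex fps) ^ (a + b)"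
  shows "theta s d c =
    qpoch Q Q * qpoch (- fps_const s * fps_X ^ a) Q * qpoch (- fps_const s * fps_X ^ b) Q"
proof (rule fps_ext)
  fix N :: nat
  let ?X = "fps_X :: complex fps" and ?e = "\<lambda>k. d * k\<^sup>2 + c * k"
  let ?A = "- fps_const s * ?X ^ a" and ?B = "- fps_const s * ?X ^ b"
  \<comment> \<open>Indices with |j - n| <= N then satisfy j > N and 2n - j > N, the range in which
    \<open>qb\<close> holds.\<close>
  define n where "n = 2 * N + 1"
  define W where "W = qpoch Q Q"
  have ab: "int a + int b = 2 * d" and c: "c = int a - d" and cd: "\<bar>c\<bar> < d"
    using a b pos by auto
  have 0: "?A $ 0 = 0" "?B $ 0 = 0" "Q $ 0 = 0" using pos by (auto simp: Q_def)
  have P: "qpart Q Q m = (\<Prod>i<m. 1 - Q ^ Suc i)" for m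
    by (simp add: qpart_def)
  have W0: "W $ 0 = 1" unfolding W_def using 0 by simp
  have WP: "trunc_eq N W (qpart Q Q m)" if "N < m" for m
    unfolding W_def using 0 that by (intro qpoch_trunc) auto
  have qb: "trunc_eq N (W * qbinomial Q (2 * n) j) 1" if "N < j" "N < 2 * n - j" "j \<le> 2 * n" for j :: nat
  proof -
    have eq: "qbinomial Q (2 * n) j * (qpart Q Q j * qpart Q Q (2 * n - j)) = qpart Q Q (2 * n)"
      using qbinomial_closed[of Q j "2 * n - j"] that(3) unfolding P by simp
    have "trunc_eq N (qbinomial Q (2 * n) j * (W * W)) (qbinomial Q (2 * n) j * (qpart Q Q j * qpart Q Q (2 * n - j)))"
      using that by (intro trunc_eq_mult WP trunc_eq_refl)
    also have "trunc_eq N \<dots> W"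
      unfolding eq using that by (intro trunc_eq_sym[OF WP]) auto
    finally have "trunc_eq N (qbinomial Q (2 * n) j * (W * W) * inverse W) (W * inverse W)"
      by (intro trunc_eq_mult trunc_eq_refl)
    moreover have "W * inverse W = 1" using W0 by (simp add: inverse_mult_eq_1')
    ultimately show ?thesis by (simp add: mult.assoc) (simp add: mult.commute)
  qed
  have "trunc_eq N (W * qpoch ?A Q * qpoch ?B Q) (W * qpart ?A Q n * qpart ?B Q n)"
    using 0 by (intro trunc_eq_mult trunc_eq_refl qpoch_trunc) (auto simp: n_def)
  moreover have "qpart ?A Q n * qpart ?B Q n =
      (\<Sum>j\<le>2*n. fps_const (s ^ (n + j)) * qbinomial Q (2 * n) j * ?X ^ nat (?e (int j - int n)))"
    using jacobi_finite[OF s ab, of n] by (simp add: qpart_def c Q_def del: fps_const_neg)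
  ultimately have "(W * qpoch ?A Q * qpoch ?B Q) $ N =
      (\<Sum>j\<le>2*n. fps_const (s ^ (n + j)) * (?X ^ nat (?e (int j - int n)) * (W * qbinomial Q (2 * n) j))) $ N"
    by (simp add: trunc_eq_def mult.assoc sum_distrib_left mult.left_commute)
      (simp add: mult.commute)
  also have "\<dots> = (\<Sum>j\<le>2*n. if ?e (int j - int n) = int N then s ^ (n + j) else 0)"
    unfolding fps_sum_nth
  proof (rule sum.cong)
    fix j assume j: "j \<in> {..2*n}"
    let ?k = "int j - int n"
    \<comment> \<open>An exponent above N does not reach this coefficient; otherwise this bound
      brings j within N of n, where \<open>qb\<close> applies.\<close>
    have ge: "\<bar>?k\<bar> \<le> ?e ?k" using cd by (rule quadratic_ge_abs)
    show "(fps_const (s ^ (n + j)) * (?X ^ nat (?e ?k) * (W * qbinomial Q (2 * n) j))) $ N =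
      (if ?e ?k = int N then s ^ (n + j) else 0)"
    proof (cases "?e ?k \<le> int N")
      case True
      with ge have "\<bar>?k\<bar> \<le> int N" by linarith
      then have "int j - int n \<le> int N" "int n - int j \<le> int N" by linarith+
      moreover have "int n = 2 * int N + 1" by (simp add: n_def)
      ultimately have "N < j" "N + j < 2 * n" by linarith+
      then have "N < j" "N < 2 * n - j" by auto
      with j have "trunc_eq N (W * qbinomial Q (2 * n) j) 1" by (intro qb) auto
      then have "(W * qbinomial Q (2 * n) j) $ (N - nat (?e ?k)) = 1 $ (N - nat (?e ?k))"
        by (auto simp: trunc_eq_def)
      moreover have "nat (?e ?k) \<le> N" using True by linarith
      moreover have "N - nat (?e ?k) = 0 \<longleftrightarrow> ?e ?k = int N" using True ge by linarith
      ultimately show ?thesis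
        by (simp add: fps_X_power_mult_nth)
    next
      case False
      then have "N < nat (?e ?k)" by linarith
      with False show ?thesis by (simp add: fps_X_power_mult_nth)
    qed
  qed auto
  also have "\<dots> = (\<Sum>j | j \<le> 2 * n \<and> ?e (int j - int n) = int N. s ^ (n + j))"
    by (simp add: sum.If_cases Int_def)
  also have "\<dots> = (\<Sum>k | k \<in> UNIV \<and> ?e k = int N. sgn_pow s k)"
  proof (rule sum.reindex_bij_witness[where i = "\<lambda>k. nat (k + int n)" and j = "\<lambda>j. int j - int n"])
    fix k assume k: "k \<in> {k. k \<in> UNIV \<and> ?e k = int N}"
    have "\<bar>k\<bar> \<le> ?e k" using cd by (rule quadratic_ge_abs)
    with k have kn: "\<bar>k\<bar> \<le> int n" unfolding n_def by simp
    then show "int (nat (k + int n)) - int n = k" by simp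
    have "nat (k + int n) \<le> 2 * n" "int (nat (k + int n)) - int n = k" using kn by linarith+
    with k show "nat (k + int n) \<in> {j. j \<le> 2 * n \<and> ?e (int j - int n) = int N}"
      by simp
  next
    fix j assume "j \<in> {j. j \<le> 2 * n \<and> ?e (int j - int n) = int N}"
    have s2: "s ^ (2 * m) = 1" for m :: nat using s by (simp add: power_mult power2_eq_square)
    have e: "even (int j - int n) = even (n + j)" by auto
    show "sgn_pow s (int j - int n) = s ^ (n + j)"
    proof (cases "even (n + j)")
      case True
      then obtain m where "n + j = 2 * m" by (elim evenE)
      then show ?thesis unfolding sgn_pow_def e by (simp add: s2)
    next
      case False
      then obtain m where "n + j = 2 * m + 1" by (elim oddE)
      then show ?thesis unfolding sgn_pow_def e by (simp add: s2)
    qed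
  qed auto
  also have "\<dots> = theta s d c $ N" by (simp add: theta_def fsum_nth)
  finally show "theta s d c $ N = (qpoch Q Q * qpoch ?A Q * qpoch ?B Q) $ N"
    by (simp add: W_def)
qed

section \<open>Products of two theta series\<close>

text \<open>Here m + n - r = 2u and m - n - r = 2v, so the parity condition is exactly the
  integrality of u and v.\<close>

lemma bij_betw_sum_diff:
  "bij_betw (\<lambda>(u, v). (u + v + r, u - v)) UNIV {(m, n). even (m + n - r)}" for r :: int
proof (rule bij_betwI[where g = "\<lambda>(m, n). ((m + n - r) div 2, (m - n - r) div 2)"])
  show "(case (case y of (m, n) \<Rightarrow> ((m + n - r) div 2, (m - n - r) div 2)) of (u, v) \<Rightarrow> (u + v + r, u - v)) = y"
    if "y \<in> {(m, n). even (m + n - r)}" for y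
  proof -
    obtain m n where y: "y = (m, n)" by force
    with that have "even (m + n - r)" by (simp only: mem_Collect_eq prod.case)
    then obtain t where "m + n - r = 2 * t" by (rule evenE)
    then have h: "(m + n - r) div 2 = t" "(m - n - r) div 2 = t - n" and m: "m = 2 * t + r - n"
      by presburger+
    show ?thesis unfolding y prod.case h by (simp add: m)
  qed
qed auto

lemma fsum_parity:
  fixes e :: "int \<times> int \<Rightarrow> int"
  assumes "fsum_ok UNIV e"
  shows "fsum UNIV c e =
    fsum UNIV (\<lambda>(u, v). c (u + v, u - v)) (\<lambda>(u, v). e (u + v, u - v)) +
    fsum UNIV (\<lambda>(u, v). c (u + v + 1, u - v)) (\<lambda>(u, v). e (u + v + 1, u - v))"
proof -
  have *: "fsum {(m, n). even (m + n - r)} c e =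
    fsum UNIV (\<lambda>(u, v). c (u + v + r, u - v)) (\<lambda>(u, v). e (u + v + r, u - v))" for r
    by (rule fsum_reindex[symmetric], rule bij_betw_sum_diff) auto
  have "fsum UNIV c e = fsum {(m, n). even (m + n - 0)} c e + fsum {(m, n). even (m + n - 1)} c e"
    by (subst fsum_split[OF assms, where P = "\<lambda>(m, n). even (m + n)"]) (simp add: case_prod_unfold)
  then show ?thesis unfolding * by simp
qed

lemma fsum_ok_times_UNIV:
  "fsum_ok UNIV e \<Longrightarrow> fsum_ok UNIV e' \<Longrightarrow> fsum_ok UNIV (\<lambda>(i, j). e i + e' j)"
  using fsum_ok_times[of UNIV e UNIV e'] by simp

lemma fsum_mult_UNIV:
  "fsum_ok UNIV e \<Longrightarrow> fsum_ok UNIV e' \<Longrightarrow> fsum UNIV c e * fsum UNIV c' e' =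
    fsum UNIV (\<lambda>(i, j). c i * c' j) (\<lambda>(i, j). e i + e' j)"
  using fsum_mult[of UNIV e UNIV e'] by simp

text \<open>In the coordinates (m, n) = (u + v + r, u - v) the exponent has no mixed term u v. The
  opposite signs make s^m (-s)^n equal to (-1)^(u+v), times s for r = 1, so each half factors. The
  bounds c1 + c2 < 0 and c1 - c2 < 0 keep the shifted linear coefficients below 2d.\<close>

lemma theta_mult_theta:
  fixes d c1 c2 :: int
  assumes s: "s * s = 1" and k: "int k = d + c1"
    and "\<bar>c1\<bar> < d" "\<bar>c2\<bar> < d" "c1 + c2 < 0" "c1 - c2 < 0"
  shows "theta s d c1 * theta (- s) d c2 =
    theta (-1) (2 * d) (c1 + c2) * theta (-1) (2 * d) (c1 - c2) +
    fps_const s * fps_X ^ k * (theta (-1) (2 * d) (2 * d + c1 + c2) * theta (-1) (2 * d) (2 * d + c1 - c2))"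
proof -
  have ok: "fsum_ok UNIV (\<lambda>n. d * n\<^sup>2 + c1 * n)" "fsum_ok UNIV (\<lambda>n. d * n\<^sup>2 + c2 * n)"
    "fsum_ok UNIV (\<lambda>n. 2 * d * n\<^sup>2 + (c1 + c2) * n)" "fsum_ok UNIV (\<lambda>n. 2 * d * n\<^sup>2 + (c1 - c2) * n)"
    "fsum_ok UNIV (\<lambda>n. 2 * d * n\<^sup>2 + (2 * d + c1 + c2) * n)" "fsum_ok UNIV (\<lambda>n. 2 * d * n\<^sup>2 + (2 * d + c1 - c2) * n)"
    using assms(3-) by (auto intro!: theta_ok)
  show ?thesis
    unfolding theta_def
    apply (subst fsum_mult_UNIV[OF ok(1,2)], subst fsum_parity[OF fsum_ok_times_UNIV[OF ok(1,2)]])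
    apply (subst fsum_mult_UNIV[OF ok(3,4)], subst fsum_mult_UNIV[OF ok(5,6)])
    apply (subst mult.assoc, subst fsum_X_power_mult[OF fsum_ok_times_UNIV[OF ok(5,6)]], subst fsum_cmult)
    apply (rule arg_cong2[of _ _ _ _ "(+)"]; rule arg_cong2[of _ _ _ _ "fsum UNIV"])
       apply (auto simp: fun_eq_iff sgn_pow_def algebra_simps power2_eq_square s k)
    done
qed

section \<open>The quintuple product identity\<close>

text \<open>With Q = q^(2d) and z = q^a this is the sum of (-1)^m Q^((3m^2-m)/2) z^(3m) (1 + z Q^m),
  the series side of the quintuple product identity.\<close>

definition quintuple :: "int \<Rightarrow> int \<Rightarrow> complex fps" where
  "quintuple d a = fsum UNIV (sgn_pow (-1)) (\<lambda>m. 3 * d * m\<^sup>2 + (3 * a - d) * m)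
     + fsum UNIV (sgn_pow (-1)) (\<lambda>m. 3 * d * m\<^sup>2 + (3 * a + d) * m + a)"

lemma quintuple_ok:
  fixes a d :: int
  assumes "0 < a" "a < d"
  shows "fsum_ok UNIV (\<lambda>m. 3 * d * m\<^sup>2 + (3 * a - d) * m)"
    and "fsum_ok UNIV (\<lambda>m. 3 * d * m\<^sup>2 + (3 * a + d) * m + a)"
proof -
  show "fsum_ok UNIV (\<lambda>m. 3 * d * m\<^sup>2 + (3 * a - d) * m)"
    using assms theta_ok[of "3 * a - d" "3 * d"] by simp
  \<comment> \<open>The linear coefficient 3a + d may exceed 3d, outside the range of
    \<open>theta_ok\<close>. For negative m the substitution m = -1 - p gives a polynomial in p with
    nonnegative coefficients.\<close>
  have *: "\<bar>m\<bar> \<le> 3 * d * m\<^sup>2 + (3 * a + d) * m + a + 1 \<and> 0 \<le> 3 * d * m\<^sup>2 + (3 * a + d) * m + a" for m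
  proof (cases "0 \<le> m")
    case True
    have "0 \<le> 3 * d * m\<^sup>2" using assms by simp
    moreover have "1 * m \<le> (3 * a + d) * m"
      using assms True by (intro mult_right_mono) auto
    ultimately show ?thesis using assms True by linarith
  next
    case False
    define p where "p = - 1 - m"
    have p: "0 \<le> p" "m = - 1 - p" using False by (auto simp: p_def)
    have "3 * d * m\<^sup>2 + (3 * a + d) * m + a = 3 * d * p\<^sup>2 + (5 * d - 3 * a) * p + 2 * (d - a)"
      by (simp add: p(2) algebra_simps power2_eq_square)
    moreover have "0 + 1 * p + 0 \<le> 3 * d * p\<^sup>2 + (5 * d - 3 * a) * p + 2 * (d - a)"
      using assms p(1) by (intro add_mono mult_right_mono) auto
    moreover have "\<bar>m\<bar> = p + 1" using p by simp
    ultimately show ?thesis using p(1) by simp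
  qed
  show "fsum_ok UNIV (\<lambda>m. 3 * d * m\<^sup>2 + (3 * a + d) * m + a)"
    using * by (intro fsum_ok_quadratic[where N = 1]) auto
qed

text \<open>Both sides are sums over the plane lattice with the quadratic form $3m^2 + n^2$. Its isometries
  coming from the Eisenstein integers preserve the lattice only on points with $m + n$ of fixed
  parity. In the coordinates $(m, n) = (u + v, u - v)$ or $(u + v + 1, u - v)$ of these
  halves they become unimodular. They match two of the four halves on the left with the right-hand side
  and cancel the other two.\<close>

theorem quintuple_product:
  fixes a d :: int
  assumes a: "0 < a" "a < d"
  shows "quintuple d a * theta (-1) d (a - d) = theta (-1) (3 * d) d * theta (-1) d (2 * a - d)"
proof -
  let ?c = "\<lambda>(m, n). sgn_pow (-1) m * sgn_pow (-1) n"
  let ?e1 = "\<lambda>(m::int, n::int). 3 * d * m\<^sup>2 + (3 * a - d) * m + (d * n\<^sup>2 + (a - d) * n)"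
  let ?e2 = "\<lambda>(m::int, n::int). 3 * d * m\<^sup>2 + (3 * a + d) * m + a + (d * n\<^sup>2 + (a - d) * n)"
  let ?e3 = "\<lambda>(m::int, n::int). 3 * d * m\<^sup>2 + d * m + (d * n\<^sup>2 + (2 * a - d) * n)"
  \<comment> \<open>The sign (-1)^(m+n) is constant on each half: 1 on the even one, -1 on the odd
    one.\<close>
  let ?ev = "\<lambda>e. fsum UNIV (\<lambda>_. 1) (\<lambda>(u, v). e (u + v, u - v))"
  let ?od = "\<lambda>e. fsum UNIV (\<lambda>_. -1) (\<lambda>(u, v). e (u + v + 1, u - v))"
  have ok: "fsum_ok UNIV (\<lambda>n. d * n\<^sup>2 + (a - d) * n)" "fsum_ok UNIV (\<lambda>n. d * n\<^sup>2 + (2 * a - d) * n)"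
    "fsum_ok UNIV (\<lambda>m. 3 * d * m\<^sup>2 + d * m)"
    using a by (auto intro!: theta_ok)
  have ok': "fsum_ok UNIV ?e1" "fsum_ok UNIV ?e2" "fsum_ok UNIV ?e3"
    using fsum_ok_times[OF quintuple_ok(1)[OF a] ok(1)] fsum_ok_times[OF quintuple_ok(2)[OF a] ok(1)]
      fsum_ok_times[OF ok(3) ok(2)] by simp_all
  have split: "fsum UNIV ?c e = ?ev e + ?od e" if "fsum_ok UNIV e" for e :: "int \<times> int \<Rightarrow> int"
    unfolding fsum_parity[OF that]
    by (rule arg_cong2[of _ _ _ _ "(+)"]; rule arg_cong2[of _ _ _ _ "fsum UNIV"])
      (auto simp: fun_eq_iff sgn_pow_def)
  \<comment> \<open>In the (m, n) plane the map is m' = (m - n)/2, n' = (3m + n)/2, for which 3 m'^2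
    + n'^2 = 3 m^2 + n^2.\<close>
  have 1: "?ev ?e1 = ?ev ?e3"
  proof (rule fsum_reindex)
    show "bij (\<lambda>(u, v). (u + v, - u) :: int \<times> int)"
      by (rule bij_betwI[where g = "\<lambda>(u, v). (- v, u + v)"]) auto
  qed (auto simp: algebra_simps power2_eq_square)
  have 2: "?od ?e2 = ?od ?e3"
  proof (rule fsum_reindex)
    show "bij (\<lambda>(u, v). (u, - u - v - 2) :: int \<times> int)"
      by (rule bij_betwI[where g = "\<lambda>(u, v). (u, - u - v - 2)"]) auto
  qed (auto simp: algebra_simps power2_eq_square)
  have 3: "?od ?e1 = - ?ev ?e2"
    unfolding fsum_uminus
  proof (rule fsum_reindex)
    show "bij (\<lambda>(u, v). (u + v + 1, - v - 1) :: int \<times> int)"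
      by (rule bij_betwI[where g = "\<lambda>(u, v). (u + v, - v - 1)"]) auto
  qed (auto simp: algebra_simps power2_eq_square)
  have "quintuple d a * theta (-1) d (a - d) = fsum UNIV ?c ?e1 + fsum UNIV ?c ?e2"
    unfolding quintuple_def theta_def distrib_right[where 'a = "complex fps"]
    by (simp only: fsum_mult_UNIV[OF quintuple_ok(1)[OF a] ok(1)] fsum_mult_UNIV[OF quintuple_ok(2)[OF a] ok(1)])
  also have "\<dots> = ?ev ?e1 + ?od ?e1 + (?ev ?e2 + ?od ?e2)"
    by (simp only: split[OF ok'(1)] split[OF ok'(2)])
  also have "\<dots> = ?ev ?e3 + ?od ?e3"
    unfolding 1 2 3 by simp
  also have "\<dots> = fsum UNIV ?c ?e3"
    by (rule split[OF ok'(3), symmetric])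
  also have "\<dots> = theta (-1) (3 * d) d * theta (-1) d (2 * a - d)"
    unfolding theta_def by (simp add: fsum_mult_UNIV[OF ok(3) ok(2)])
  finally show ?thesis .
qed

section \<open>Arithmetic progressions modulo 5\<close>

definition mod5_part :: "nat \<Rightarrow> complex fps \<Rightarrow> complex fps" where
  "mod5_part r F = Abs_fps (\<lambda>n. F $ (5 * n + r))"

definition dilate :: "complex fps \<Rightarrow> complex fps" where
  "dilate F = Abs_fps (\<lambda>n. if 5 dvd n then F $ (n div 5) else 0)"

lemma mod5_part_nth: "mod5_part r F $ n = F $ (5 * n + r)"
  by (simp add: mod5_part_def)

lemma dilate_nth: "dilate F $ n = (if 5 dvd n then F $ (n div 5) else 0)"
  by (simp add: dilate_def)

lemma mod5_part_add: "mod5_part r (F + G) = mod5_part r F + mod5_part r G"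
  by (simp add: fps_eq_iff mod5_part_nth)

text \<open>Only indices i = 5j contribute, and r < 5 confines them to j <= n. Series in q^5 thus
  act as scalars for the extraction.\<close>

lemma mod5_part_dilate:
  assumes "r < 5"
  shows "mod5_part r (dilate F * G) = F * mod5_part r G"
proof (rule fps_ext)
  fix n
  have "mod5_part r (dilate F * G) $ n = (\<Sum>i=0..5*n+r. dilate F $ i * G $ (5 * n + r - i))"
    by (simp add: mod5_part_nth fps_mult_nth)
  also have "\<dots> = (\<Sum>i\<in>(*) 5 ` {0..n}. dilate F $ i * G $ (5 * n + r - i))"
  proof (rule sum.mono_neutral_right)
    have "i \<in> (*) 5 ` {0..n}" if i: "i \<le> 5 * n + r" "5 dvd i" for i
    proof -
      from i(2) obtain j where "i = 5 * j" by (rule dvdE)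
      with i(1) assms show ?thesis by auto
    qed
    then show "\<forall>i\<in>{0..5 * n + r} - (*) 5 ` {0..n}. dilate F $ i * G $ (5 * n + r - i) = 0"
      by (auto simp: dilate_nth)
  qed auto
  also have "\<dots> = (\<Sum>j=0..n. dilate F $ (5 * j) * G $ (5 * n + r - 5 * j))"
    by (subst sum.reindex) (auto simp: inj_on_def)
  also have "\<dots> = (\<Sum>j=0..n. F $ j * G $ (5 * (n - j) + r))"
    by (rule sum.cong) (auto simp: dilate_nth diff_mult_distrib2)
  also have "\<dots> = (F * mod5_part r G) $ n"
    by (simp add: fps_mult_nth mod5_part_nth)
  finally show "mod5_part r (dilate F * G) $ n = (F * mod5_part r G) $ n" .
qed

lemma dilate_eq_compose: "dilate F = F oo fps_X ^ 5"
  by (rule fps_ext) (simp add: dilate_nth fps_nth_compose_X_power)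

text \<open>On partial products the substitution of q^5 is a ring homomorphism, and both
  coefficients at n are determined by the first n + 1 factors.\<close>

lemma dilate_qpoch:
  assumes "a > 0" "b > 0"
  shows "dilate (qpoch (fps_X ^ a) (fps_X ^ b)) = qpoch (fps_X ^ (5 * a)) (fps_X ^ (5 * b))"
proof (rule fps_ext)
  fix n
  have "dilate (qpoch (fps_X ^ a) (fps_X ^ b)) $ n = dilate (qpart (fps_X ^ a) (fps_X ^ b) (Suc n)) $ n"
    using qpoch_trunc[of "fps_X ^ a" "fps_X ^ b" "n div 5" "Suc n"] assms
    by (simp add: dilate_nth trunc_eq_def)
  also have "dilate (qpart (fps_X ^ a) (fps_X ^ b) N) = qpart (fps_X ^ (5 * a)) (fps_X ^ (5 * b)) N" for N
    unfolding dilate_eq_compose qpart_def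
    by (simp add: fps_compose_prod_distrib fps_compose_sub_distrib fps_compose_mult_distrib
        fps_compose_power[symmetric] fps_X_fps_compose_startby0 mult.assoc flip: power_mult)
  also have "qpart (fps_X ^ (5 * a)) (fps_X ^ (5 * b)) (Suc n) $ n = qpoch (fps_X ^ (5 * a)) (fps_X ^ (5 * b)) $ n"
    using qpoch_trunc[of "fps_X ^ (5 * a)" "fps_X ^ (5 * b)" n "Suc n"] assms
    by (simp add: trunc_eq_def)
  finally show "dilate (qpoch (fps_X ^ a) (fps_X ^ b)) $ n = qpoch (fps_X ^ (5 * a)) (fps_X ^ (5 * b)) $ n" .
qed

lemma fps_dissect:
  "F = dilate (mod5_part 0 F) + fps_X * dilate (mod5_part 1 F) + fps_X ^ 2 * dilate (mod5_part 2 F)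
     + fps_X ^ 3 * dilate (mod5_part 3 F) + fps_X ^ 4 * dilate (mod5_part 4 F)"
proof -
  have "F $ n = (\<Sum>r<5. fps_X ^ r * dilate (mod5_part r F)) $ n" for n
  proof -
    have "(\<Sum>r<5. fps_X ^ r * dilate (mod5_part r F)) $ n =
        (\<Sum>r<5. if r = n mod 5 then F $ n else 0)"
      unfolding fps_sum_nth
    proof (rule sum.cong)
      fix r :: nat assume "r \<in> {..<5}"
      then have r: "r < 5" by simp
      show "(fps_X ^ r * dilate (mod5_part r F)) $ n = (if r = n mod 5 then F $ n else 0)"
      proof (cases "n < r")
        case True
        with r have "n mod 5 = n" by simp
        with True show ?thesis by (simp add: fps_X_power_mult_nth)
      next
        case False
        then obtain m where n: "n = r + m" using le_iff_add[of r n] by auto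
        have "n mod 5 = r mod 5 \<longleftrightarrow> 5 dvd m"
          using mod_eq_dvd_iff_nat[of r n 5] by (simp add: n)
        then have "5 dvd m \<longleftrightarrow> r = n mod 5" using r by auto
        moreover have "5 * (m div 5) + r = n" if "5 dvd m" using that by (simp add: n)
        ultimately show ?thesis
          using n by (auto simp: fps_X_power_mult_nth dilate_nth mod5_part_nth add_ac)
      qed
    qed auto
    then show ?thesis by simp
  qed
  then have "F = (\<Sum>r<5. fps_X ^ r * dilate (mod5_part r F))" by (rule fps_ext)
  also have "\<dots> = dilate (mod5_part 0 F) + fps_X * dilate (mod5_part 1 F) + fps_X ^ 2 * dilate (mod5_part 2 F)
     + fps_X ^ 3 * dilate (mod5_part 3 F) + fps_X ^ 4 * dilate (mod5_part 4 F)"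
    by (simp add: numeral_eq_Suc)
  finally show ?thesis .
qed

text \<open>Multiplication by q^k shifts the residue classes; when r < k the class wraps around, and
  the surplus q^5 becomes q after extraction.\<close>

lemma mod5_part_X_power:
  assumes "k < 5" "r < 5"
  shows "mod5_part r (fps_X ^ k * F) =
    (if k \<le> r then mod5_part (r - k) F else fps_X * mod5_part (r + 5 - k) F)"
proof (rule fps_ext)
  fix n
  show "mod5_part r (fps_X ^ k * F) $ n =
    (if k \<le> r then mod5_part (r - k) F else fps_X * mod5_part (r + 5 - k) F) $ n"
    using assms by (cases n) (auto simp: mod5_part_nth fps_X_power_mult_nth add_ac)
qed

lemma mod5_part_X_power_dilate:
  assumes "k < 5" "r < 5"
  shows "mod5_part r (fps_X ^ k * dilate F * G) =
    F * (if k \<le> r then mod5_part (r - k) G else fps_X * mod5_part (r + 5 - k) G)"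
proof -
  have "fps_X ^ k * dilate F * G = dilate F * (fps_X ^ k * G)" by (simp add: mult_ac)
  then show ?thesis by (simp only: mod5_part_dilate[OF assms(2)] mod5_part_X_power[OF assms])
qed

lemma mod5_part_fsum:
  assumes "r < 5"
  shows "mod5_part r (fsum A c e) = fsum {i\<in>A. e i mod 5 = int r} c (\<lambda>i. (e i - int r) div 5)"
proof (rule fps_ext)
  fix n
  have "{i \<in> A. e i = int (5 * n + r)} =
    {i \<in> {i\<in>A. e i mod 5 = int r}. (e i - int r) div 5 = int n}"
  proof -
    have "x = int (5 * n + r) \<longleftrightarrow> x mod 5 = int r \<and> (x - int r) div 5 = int n" for x
    proof
      assume x: "x mod 5 = int r \<and> (x - int r) div 5 = int n"
      then have "x mod 5 = int r mod 5" using assms by simp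
      then have "5 dvd x - int r" by (simp add: mod_eq_dvd_iff)
      with x show "x = int (5 * n + r)" by auto
    qed (use assms in auto)
    then show ?thesis by auto
  qed
  then show "mod5_part r (fsum A c e) $ n = fsum {i\<in>A. e i mod 5 = int r} c (\<lambda>i. (e i - int r) div 5) $ n"
    by (simp add: mod5_part_nth fsum_nth)
qed

lemma quadratic_mod_5: "(p * k\<^sup>2 + q * k) mod 5 = (p * (k mod 5)\<^sup>2 + q * (k mod 5)) mod (5::int)"
  by (intro mod_add_cong mod_mult_cong) (simp_all add: power_mod)

lemma mod_5_cases: "k mod 5 = 0 \<or> k mod 5 = 1 \<or> k mod 5 = 2 \<or> k mod 5 = 3 \<or> k mod 5 = (4::int)"
  by presburger

text \<open>The sign \<open>u\<close> is the direction in which the residue class is run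
  through.\<close>

lemma bij_betw_mod_5:
  fixes u r :: int
  assumes "u = 1 \<or> u = - 1"
  shows "bij_betw (\<lambda>m. u * (5 * m) + r) UNIV {k. k mod 5 = r mod 5}"
proof (rule bij_betwI[where g = "\<lambda>k. u * ((k - r) div 5)"])
  show "u * (5 * (u * ((k - r) div 5))) + r = k" if "k \<in> {k. k mod 5 = r mod 5}" for k
  proof -
    have "5 dvd k - r" using that by (simp add: mod_eq_dvd_iff)
    then show ?thesis using assms by auto
  qed
qed (use assms in \<open>auto simp: mod_eq_dvd_iff\<close>)

lemma mod5_part_ok:
  assumes "fsum_ok A e" "r < 5"
  shows "fsum_ok {i\<in>A. e i mod 5 = int r} (\<lambda>i. (e i - int r) div 5)"
  unfolding fsum_ok_def
proof (intro conjI ballI allI)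
  fix i assume i: "i \<in> {i\<in>A. e i mod 5 = int r}"
  then have "0 \<le> e i" using assms by (auto dest: fsum_ok_nonneg)
  then have "e i mod 5 \<le> e i" by (simp add: zmod_le_nonneg_dividend)
  with i show "0 \<le> (e i - int r) div 5" by simp
next
  fix n
  have "{i \<in> {i\<in>A. e i mod 5 = int r}. (e i - int r) div 5 \<le> n} \<subseteq> {i\<in>A. e i \<le> 5 * n + 10}"
    using assms(2) by auto
  then show "finite {i \<in> {i\<in>A. e i mod 5 = int r}. (e i - int r) div 5 \<le> n}"
    using assms(1) unfolding fsum_ok_def by (meson finite_subset)
qed

text \<open>The index set splits into two progressions. Their representatives i, j and directions u,
  v are left free so that both exponents can be brought to the form of the target series.\<close>

lemma mod5_part_two_classes:
  assumes ok: "fsum_ok UNIV (\<lambda>k. d * k\<^sup>2 + c * k)" and r: "r < 5"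
    and cls: "\<And>k. (d * k\<^sup>2 + c * k) mod 5 = int r \<longleftrightarrow> k mod 5 = i mod 5 \<or> k mod 5 = j mod 5"
    and ij: "i mod 5 \<noteq> j mod 5"
    and uv: "u = 1 \<or> u = - 1" "v = 1 \<or> v = - 1"
    and e: "\<And>m. d * (u * (5 * m) + i)\<^sup>2 + c * (u * (5 * m) + i) = 5 * e m + int r"
    and e': "\<And>m. d * (v * (5 * m) + j)\<^sup>2 + c * (v * (5 * m) + j) = 5 * e' m + int r"
    and a: "\<And>m. sgn_pow s (u * (5 * m) + i) = a m" and b: "\<And>m. sgn_pow s (v * (5 * m) + j) = b m"
  shows "mod5_part r (theta s d c) = fsum UNIV a e + fsum UNIV b e'"
proof -
  let ?A = "{k \<in> UNIV. (d * k\<^sup>2 + c * k) mod 5 = int r}"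
  let ?e = "\<lambda>k. (d * k\<^sup>2 + c * k - int r) div 5"
  have A: "{k \<in> ?A. k mod 5 = i mod 5} = {k. k mod 5 = i mod 5}"
    "{k \<in> ?A. k mod 5 \<noteq> i mod 5} = {k. k mod 5 = j mod 5}"
    using ij unfolding cls by auto
  have "mod5_part r (theta s d c) = fsum ?A (sgn_pow s) ?e"
    unfolding theta_def by (rule mod5_part_fsum[OF r])
  also have "\<dots> = fsum {k. k mod 5 = i mod 5} (sgn_pow s) ?e + fsum {k. k mod 5 = j mod 5} (sgn_pow s) ?e"
    by (subst fsum_split[OF mod5_part_ok[OF ok r], where P = "\<lambda>k. k mod 5 = i mod 5"]) (simp only: A)
  also have "fsum {k. k mod 5 = i mod 5} (sgn_pow s) ?e = fsum UNIV a e"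
  proof (rule fsum_reindex[symmetric, OF bij_betw_mod_5[OF uv(1)]])
    show "(d * (u * (5 * m) + i)\<^sup>2 + c * (u * (5 * m) + i) - int r) div 5 = e m" for m
      unfolding e by simp
  qed (rule a)
  also have "fsum {k. k mod 5 = j mod 5} (sgn_pow s) ?e = fsum UNIV b e'"
  proof (rule fsum_reindex[symmetric, OF bij_betw_mod_5[OF uv(2)]])
    show "(d * (v * (5 * m) + j)\<^sup>2 + c * (v * (5 * m) + j) - int r) div 5 = e' m" for m
      unfolding e' by simp
  qed (rule b)
  finally show ?thesis .
qed

lemma mod5_part_eq_0:
  assumes "r < 5" "\<And>k. (d * k\<^sup>2 + c * k) mod 5 \<noteq> int r"
  shows "mod5_part r (theta s d c) = 0"
  unfolding theta_def mod5_part_fsum[OF assms(1)] by (simp add: assms(2) fps_eq_iff fsum_nth)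

section \<open>Dissections of E_4 and psi(q^2) modulo 5\<close>

context
begin

private lemma table1:
  "(6 * k\<^sup>2 + (-2) * k) mod 5 = (if k mod 5 = 0 \<or> k mod 5 = 2 then 0 else if k mod 5 = 1 then 4 else 3 :: int)"
  using mod_5_cases[of k] by (subst quadratic_mod_5) auto

private lemma table2:
  "(1 * k\<^sup>2 + 1 * k) mod 5 = (if k mod 5 = 0 \<or> k mod 5 = 4 then 0 else if k mod 5 = 2 then 1 else 2 :: int)"
  using mod_5_cases[of k] by (subst quadratic_mod_5) auto

text \<open>Residues 0 and 3 of the exponent have two roots k modulo 5 each, and the two
  progressions give the two halves of a quintuple series. Residues 1 and 2 are not attained.\<close>

lemma mod5_part_theta_6_2:
  "mod5_part 0 (theta (-1) 6 (-2)) = quintuple 10 4"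
  "mod5_part 1 (theta (-1) 6 (-2)) = 0"
  "mod5_part 2 (theta (-1) 6 (-2)) = 0"
  "mod5_part 3 (theta (-1) 6 (-2)) = - (fps_X * quintuple 10 8)"
proof -
  have ok: "fsum_ok UNIV (\<lambda>k::int. 6 * k\<^sup>2 + (-2) * k)" by (rule theta_ok) simp
  show "mod5_part 0 (theta (-1) 6 (-2)) = quintuple 10 4"
    unfolding quintuple_def
    by (rule mod5_part_two_classes[where u = "-1" and i = 0 and v = 1 and j = 2, OF ok])
      (unfold table1, use mod_5_cases in \<open>auto simp: algebra_simps power2_eq_square sgn_pow_def\<close>)
  show "mod5_part 1 (theta (-1) 6 (-2)) = 0"
    by (rule mod5_part_eq_0, simp, unfold table1, simp)
  show "mod5_part 2 (theta (-1) 6 (-2)) = 0"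
    by (rule mod5_part_eq_0, simp, unfold table1, simp)
  \<comment> \<open>The odd starting points -1 and 3 produce the minus sign; the 1 common to both
    exponents produces the factor q.\<close>
  have "mod5_part 3 (theta (-1) 6 (-2)) =
    fsum UNIV (\<lambda>m. - sgn_pow (-1) m) (\<lambda>m. int 1 + (3 * 10 * m\<^sup>2 + (3 * 8 - 10) * m))
    + fsum UNIV (\<lambda>m. - sgn_pow (-1) m) (\<lambda>m. int 1 + (3 * 10 * m\<^sup>2 + (3 * 8 + 10) * m + 8))"
    by (rule mod5_part_two_classes[where u = "-1" and i = "-1" and v = 1 and j = 3, OF ok])
      (unfold table1, use mod_5_cases in \<open>auto simp: algebra_simps power2_eq_square sgn_pow_def\<close>)
  also have "\<dots> = - (fps_X ^ 1 * quintuple 10 8)"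
    unfolding quintuple_def distrib_left[where 'a = "complex fps"]
    by (subst fsum_X_power_mult[OF quintuple_ok(1)], simp, simp,
        subst fsum_X_power_mult[OF quintuple_ok(2)], simp, simp, simp only: fsum_uminus minus_add_distrib)
  finally show "mod5_part 3 (theta (-1) 6 (-2)) = - (fps_X * quintuple 10 8)" by simp
qed

text \<open>Here c = d, outside the range of \<open>theta_ok\<close>: the exponent is 0 at k = -1,
  which forces the slack N = 1.\<close>

lemma fsum_ok_triangular: "fsum_ok UNIV (\<lambda>k::int. 1 * k\<^sup>2 + 1 * k)"
proof (rule fsum_ok_quadratic[where N = 1])
  fix k :: int
  have eq: "1 * k\<^sup>2 + 1 * k = k * (k + 1)" by (simp add: algebra_simps power2_eq_square)
  show "0 \<le> 1 * k\<^sup>2 + 1 * k" unfolding eq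
    by (cases "0 \<le> k") (auto simp: zero_le_mult_iff)
  have "\<bar>k\<bar> \<le> k\<^sup>2"
  proof (cases "k = 0")
    case False
    then have "\<bar>k\<bar> * 1 \<le> \<bar>k\<bar> * \<bar>k\<bar>" by (intro mult_left_mono) auto
    then show ?thesis by (simp add: power2_eq_square)
  qed auto
  moreover have "0 \<le> k\<^sup>2 + 2 * k + 1"
    using zero_le_power2[of "k + 1"] by (simp add: power2_eq_square algebra_simps)
  ultimately show "\<bar>k\<bar> \<le> 1 * k\<^sup>2 + 1 * k + 1"
    by (cases "0 \<le> k") auto
qed

text \<open>k = 2m and k = -2m - 1 give the same exponent 4m^2 + 2m.\<close>

lemma theta_triangular: "theta 1 1 1 = 2 * theta 1 4 2"
proof -
  have "theta 1 1 1 = fsum {k \<in> UNIV. even k} (sgn_pow 1) (\<lambda>k. 1 * k\<^sup>2 + 1 * k)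
    + fsum {k \<in> UNIV. odd k} (sgn_pow 1) (\<lambda>k. 1 * k\<^sup>2 + 1 * k)"
    unfolding theta_def by (rule fsum_split[OF fsum_ok_triangular])
  also have "fsum {k \<in> UNIV. even k} (sgn_pow 1) (\<lambda>k. 1 * k\<^sup>2 + 1 * k) = theta 1 4 2"
    unfolding theta_def
  proof (rule fsum_reindex[symmetric])
    show "bij_betw (\<lambda>m. 2 * m) UNIV {k \<in> UNIV. even (k::int)}"
      by (rule bij_betwI[where g = "\<lambda>k. k div 2"]) auto
  qed (auto simp: sgn_pow_def power2_eq_square)
  also have "fsum {k \<in> UNIV. odd k} (sgn_pow 1) (\<lambda>k. 1 * k\<^sup>2 + 1 * k) = theta 1 4 2"
    unfolding theta_def
  proof (rule fsum_reindex[symmetric])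
    show "bij_betw (\<lambda>m. - 2 * m - 1) UNIV {k \<in> UNIV. odd (k::int)}"
      by (rule bij_betwI[where g = "\<lambda>k. (- k - 1) div 2"]) (auto elim!: oddE)
  qed (auto simp: sgn_pow_def algebra_simps power2_eq_square)
  finally show ?thesis by simp
qed

text \<open>The extraction is done on the doubled series \<open>theta 1 1 1\<close>, where each of
  two classes of k yields a whole theta series; in \<open>theta 1 4 2\<close> each would yield only
  half of one.\<close>

lemma mod5_part_theta_4_2:
  "mod5_part 0 (theta 1 4 2) = theta 1 5 1"
  "mod5_part 2 (theta 1 4 2) = theta 1 5 3"
  "mod5_part 3 (theta 1 4 2) = 0"
  "mod5_part 4 (theta 1 4 2) = 0"
proof -
  have 2: "mod5_part r (theta 1 1 1) = 2 * mod5_part r (theta 1 4 2)" for r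
    unfolding theta_triangular mult_2 mod5_part_add ..
  have "mod5_part 0 (theta 1 1 1) = theta 1 5 1 + theta 1 5 1"
    unfolding theta_def[of 1 5]
    by (rule mod5_part_two_classes[where u = 1 and i = 0 and v = "-1" and j = "-1", OF fsum_ok_triangular])
      (unfold table2, use mod_5_cases in \<open>auto simp: algebra_simps power2_eq_square sgn_pow_def\<close>)
  then show "mod5_part 0 (theta 1 4 2) = theta 1 5 1" unfolding 2 by (simp flip: mult_2)
  have "mod5_part 2 (theta 1 1 1) = theta 1 5 3 + theta 1 5 3"
    unfolding theta_def[of 1 5]
    by (rule mod5_part_two_classes[where u = 1 and i = 1 and v = "-1" and j = "-2", OF fsum_ok_triangular])
      (unfold table2, use mod_5_cases in \<open>auto simp: algebra_simps power2_eq_square sgn_pow_def\<close>)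
  then show "mod5_part 2 (theta 1 4 2) = theta 1 5 3" unfolding 2 by (simp flip: mult_2)
  have "mod5_part 3 (theta 1 1 1) = 0"
    by (rule mod5_part_eq_0, simp, unfold table2, simp)
  moreover have "mod5_part 4 (theta 1 1 1) = 0"
    by (rule mod5_part_eq_0, simp, unfold table2, simp)
  ultimately show "mod5_part 3 (theta 1 4 2) = 0" "mod5_part 4 (theta 1 4 2) = 0" unfolding 2 by simp_all
qed

end

lemma dilate_0: "dilate 0 = 0"
  by (simp add: fps_eq_iff dilate_nth)

text \<open>Only the classes 0, 3, 4 of \<open>F\<close> and 0, 1, 2 of \<open>G\<close> can occur.
  Modulo 5, only 0 + 2 gives 2 and only 3 + 0 gives 3.\<close>

lemma mod5_part_theta_mult:
  fixes F :: "complex fps"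
  defines "F \<equiv> theta (-1) 6 (-2)" and "G \<equiv> theta 1 4 2"
  shows "mod5_part 2 (F * G) = quintuple 10 4 * theta 1 5 3"
    and "mod5_part 3 (F * G) = - (fps_X * quintuple 10 8 * theta 1 5 1)"
proof -
  note parts = mod5_part_theta_6_2[folded F_def] mod5_part_theta_4_2[folded G_def]
  have "F = fps_X ^ 0 * dilate (mod5_part 0 F) + fps_X ^ 3 * dilate (mod5_part 3 F) + fps_X ^ 4 * dilate (mod5_part 4 F)"
    using fps_dissect[of F]
    by (simp only: parts dilate_0 mult_zero_right add_0_right power_0 mult_1_left)
  then have FG: "F * G = fps_X ^ 0 * dilate (mod5_part 0 F) * G + fps_X ^ 3 * dilate (mod5_part 3 F) * G
      + fps_X ^ 4 * dilate (mod5_part 4 F) * G"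
    by (metis distrib_right)
  show "mod5_part 2 (F * G) = quintuple 10 4 * theta 1 5 3"
    unfolding FG mod5_part_add by (subst (1 2 3) mod5_part_X_power_dilate) (simp_all add: parts)
  show "mod5_part 3 (F * G) = - (fps_X * quintuple 10 8 * theta 1 5 1)"
    unfolding FG mod5_part_add by (subst (1 2 3) mod5_part_X_power_dilate) (simp_all add: parts)
qed

section \<open>The generating function\<close>

abbreviation qp :: "nat \<Rightarrow> nat \<Rightarrow> complex fps" where
  "qp a b \<equiv> qpoch (fps_X ^ a) (fps_X ^ b)"

abbreviation qm :: "nat \<Rightarrow> nat \<Rightarrow> complex fps" where
  "qm a b \<equiv> qpoch (- (fps_X ^ a)) (fps_X ^ b)"

lemma qp_nonzero: "a > 0 \<Longrightarrow> b > 0 \<Longrightarrow> qp a b \<noteq> 0"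
  by (rule qpoch_nonzero) auto

lemma lessThan_2: "{..<2} = {0, 1 :: nat}"
  by auto

lemma qp_double:
  assumes "a > 0" "b > 0"
  shows "qp a b = qp a (2 * b) * qp (a + b) (2 * b)"
  using qpoch_split[of "fps_X ^ a" "fps_X ^ b" 2] assms
  by (simp add: lessThan_2 mult.commute[of 2 b] power_add flip: power_mult)

lemma qm_double:
  assumes "a > 0" "b > 0"
  shows "qm a b = qm a (2 * b) * qm (a + b) (2 * b)"
  using qpoch_split[of "- (fps_X ^ a)" "fps_X ^ b" 2] assms
  by (simp add: lessThan_2 mult.commute[of 2 b] power_add flip: power_mult)

lemma qp_split:
  assumes "a > 0" "b > 0" "m > 0"
  shows "qp a b = (\<Prod>i<m. qp (a + b * i) (b * m))"
  using qpoch_split[of "fps_X ^ a" "fps_X ^ b" m] assms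
  by (simp add: power_add flip: power_mult)

lemma qp_mult_qm:
  assumes "a > 0" "b > 0"
  shows "qp a b * qm a b = qp (2 * a) (2 * b)"
  using qpoch_mult_uminus[of "fps_X ^ a" "fps_X ^ b"] assms
  by (simp add: mult.commute[of 2 a] mult.commute[of 2 b] flip: power_mult)

text \<open>The variable \<open>e\<close> = 2d is separate so that instances carry plain
  numerals.\<close>

lemma theta_minus_eq:
  assumes "int a = d + c" "int b = d - c" "a > 0" "b > 0" "e = a + b"
  shows "theta (-1) d c = qp e e * qp a e * qp b e"
  using jacobi_triple_product[of "-1" a d c b] assms by simp

lemma theta_plus_eq:
  assumes "int a = d + c" "int b = d - c" "a > 0" "b > 0" "e = a + b"
  shows "theta 1 d c = qp e e * qm a e * qm b e"
  using jacobi_triple_product[of 1 a d c b] assms by simp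

lemma fps_divide_mult_cancel:
  fixes F G :: "complex fps"
  assumes "G $ 0 \<noteq> 0"
  shows "F / G * G = F"
  using assms by (simp add: fps_divide_unit mult.assoc inverse_mult_eq_1)

lemma fps_eq_divideI:
  fixes F G H :: "complex fps"
  assumes "G $ 0 \<noteq> 0" "F * G = H"
  shows "F = H / G"
proof -
  have "F * G = H / G * G" using assms by (simp add: fps_divide_mult_cancel)
  moreover have "G \<noteq> 0" using assms(1) by auto
  ultimately show ?thesis by (rule mult_right_cancel[THEN iffD1, rotated])
qed

lemma generating_function:
  fixes f :: "complex fps"
  assumes f: "f = ((qp 1 5 * qp 4 5)\<^sup>2 * (qm 4 10 * qm 6 10)) / ((qp 2 5 * qp 3 5)\<^sup>2 * (qm 2 10 * qm 8 10))"
  shows "qp 10 10 ^ 4 * f =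
    2 * qp 20 20 * qp 10 10 * (qp 4 4 * theta 1 4 2) - 2 * fps_X * qp 20 20 ^ 3 * qp 4 4 - qp 10 10 ^ 4"
proof -
  define A where "A = qp 4 20 * qp 16 20 * (qp 8 20 * qp 12 20)"
  define B where "B = qp 2 20 * qp 18 20 * (qp 6 20 * qp 14 20)"
  define S where "S = qp 1 10 * qp 9 10 * (qm 3 10 * qm 7 10)"
  \<comment> \<open>This is \<open>S\<close> with q replaced by -q.\<close>
  define S' where "S' = qm 1 10 * qm 9 10 * (qp 3 10 * qp 7 10)"
  have d10: "qp 2 10 = qp 2 20 * qp 12 20" "qp 8 10 = qp 8 20 * qp 18 20"
    "qp 4 10 = qp 4 20 * qp 14 20" "qp 6 10 = qp 6 20 * qp 16 20" "qp 10 10 = qp 10 20 * qp 20 20"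
    using qp_double[of 2 10] qp_double[of 8 10] qp_double[of 4 10] qp_double[of 6 10] qp_double[of 10 10] by simp_all
  have d5: "qp 1 5 = qp 1 10 * qp 6 10" "qp 4 5 = qp 4 10 * qp 9 10"
    "qp 2 5 = qp 2 10 * qp 7 10" "qp 3 5 = qp 3 10 * qp 8 10"
    using qp_double[of 1 5] qp_double[of 4 5] qp_double[of 2 5] qp_double[of 3 5] by simp_all
  have pm: "qp 1 10 * qm 1 10 = qp 2 20" "qp 2 10 * qm 2 10 = qp 4 20" "qp 3 10 * qm 3 10 = qp 6 20"
    "qp 4 10 * qm 4 10 = qp 8 20" "qp 6 10 * qm 6 10 = qp 12 20" "qp 7 10 * qm 7 10 = qp 14 20"
    "qp 8 10 * qm 8 10 = qp 16 20" "qp 9 10 * qm 9 10 = qp 18 20"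
    using qp_mult_qm[of 1 10] qp_mult_qm[of 2 10] qp_mult_qm[of 3 10] qp_mult_qm[of 4 10]
      qp_mult_qm[of 6 10] qp_mult_qm[of 7 10] qp_mult_qm[of 8 10] qp_mult_qm[of 9 10] by simp_all
  have E4: "qp 4 4 = A * qp 20 20"
    using qp_split[of 4 4 5] by (simp add: A_def numeral_eq_Suc mult_ac)
  have A0: "A \<noteq> 0" and B0: "B \<noteq> 0" unfolding A_def B_def by (simp_all add: qp_nonzero)
  \<comment> \<open>The left side is the product of the theta series with c = -4 (exponents 1, 9)
    and c = -2 (exponents 3, 7).\<close>
  have S: "qp 10 10 ^ 2 * S = qp 20 20 ^ 2 * (A - fps_X * B)"
  proof -
    have "theta (-1) 5 (-4) * theta (- (-1)) 5 (-2) =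
      theta (-1) (2*5) (-4 + -2) * theta (-1) (2*5) (-4 - -2) +
      fps_const (-1) * fps_X ^ 1 * (theta (-1) (2*5) (2*5 + -4 + -2) * theta (-1) (2*5) (2*5 + -4 - -2))"
      by (rule theta_mult_theta) auto
    then have "theta (-1) 5 (-4) * theta 1 5 (-2) =
      theta (-1) 10 (-6) * theta (-1) 10 (-2) - fps_X * (theta (-1) 10 4 * theta (-1) 10 8)"
      by (simp flip: fps_const_neg)
    then show ?thesis
      using theta_minus_eq[of 1 5 "-4" 9 10] theta_plus_eq[of 3 5 "-2" 7 10]
        theta_minus_eq[of 4 10 "-6" 16 20] theta_minus_eq[of 8 10 "-2" 12 20]
        theta_minus_eq[of 14 10 4 6 20] theta_minus_eq[of 18 10 8 2 20]
      by (simp add: S_def A_def B_def power2_eq_square algebra_simps)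
  qed
  have S': "qp 10 10 ^ 2 * S' = qp 20 20 ^ 2 * (A + fps_X * B)"
  proof -
    have "theta 1 5 (-4) * theta (-1) 5 (-2) =
      theta (-1) (2*5) (-4 + -2) * theta (-1) (2*5) (-4 - -2) +
      fps_const 1 * fps_X ^ 1 * (theta (-1) (2*5) (2*5 + -4 + -2) * theta (-1) (2*5) (2*5 + -4 - -2))"
      by (rule theta_mult_theta) auto
    then have "theta 1 5 (-4) * theta (-1) 5 (-2) =
      theta (-1) 10 (-6) * theta (-1) 10 (-2) + fps_X * (theta (-1) 10 4 * theta (-1) 10 8)"
      by simp
    then show ?thesis
      using theta_plus_eq[of 1 5 "-4" 9 10] theta_minus_eq[of 3 5 "-2" 7 10]
        theta_minus_eq[of 4 10 "-6" 16 20] theta_minus_eq[of 8 10 "-2" 12 20]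
        theta_minus_eq[of 14 10 4 6 20] theta_minus_eq[of 18 10 8 2 20]
      by (simp add: S'_def A_def B_def power2_eq_square algebra_simps)
  qed
  have SS': "S * S' = B"
  proof -
    have "S * S' = (qp 1 10 * qm 1 10) * (qp 9 10 * qm 9 10) * ((qp 3 10 * qm 3 10) * (qp 7 10 * qm 7 10))"
      by (simp add: S_def S'_def mult_ac)
    then show ?thesis unfolding pm B_def .
  qed
  \<comment> \<open>Multiplying by (-q^3,-q^7;q^10)^2 completes S^2 in the numerator and B in the
    denominator; the common factor A (q^6,q^14;q^20) is then cancelled.\<close>
  have fB: "f * B = S\<^sup>2"
  proof -
    have "f * ((qp 2 5 * qp 3 5)\<^sup>2 * (qm 2 10 * qm 8 10)) = (qp 1 5 * qp 4 5)\<^sup>2 * (qm 4 10 * qm 6 10)"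
      unfolding f by (rule fps_divide_mult_cancel) (simp add: power2_eq_square)
    then have "f * ((qp 2 5 * qp 3 5)\<^sup>2 * (qm 2 10 * qm 8 10)) * (qm 3 10 * qm 7 10)\<^sup>2 =
        (qp 1 5 * qp 4 5)\<^sup>2 * (qm 4 10 * qm 6 10) * (qm 3 10 * qm 7 10)\<^sup>2" by simp
    also have "\<dots> = S\<^sup>2 * (qp 4 10 * qp 6 10) * ((qp 4 10 * qm 4 10) * (qp 6 10 * qm 6 10))"
      unfolding d5 S_def by (simp add: power2_eq_square mult_ac)
    also have "\<dots> = S\<^sup>2 * (A * (qp 6 20 * qp 14 20))"
      unfolding pm unfolding d10 A_def by (simp add: mult_ac)
    also have "f * ((qp 2 5 * qp 3 5)\<^sup>2 * (qm 2 10 * qm 8 10)) * (qm 3 10 * qm 7 10)\<^sup>2 =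
        f * (qp 2 10 * qp 8 10) * ((qp 2 10 * qm 2 10) * (qp 8 10 * qm 8 10)) * ((qp 3 10 * qm 3 10) * (qp 7 10 * qm 7 10))\<^sup>2"
      unfolding d5 by (simp add: power2_eq_square mult_ac)
    also have "\<dots> = f * B * (A * (qp 6 20 * qp 14 20))"
      unfolding pm unfolding d10 A_def B_def by (simp add: power2_eq_square mult_ac)
    finally show ?thesis using A0 by (simp add: qp_nonzero)
  qed
  \<comment> \<open>f + 1 enters because f B + B = S (S + S'), and in S + S' the terms with q B
    cancel.\<close>
  have key: "qp 10 10 ^ 4 * (f + 1) * B = 2 * qp 20 20 ^ 4 * (A\<^sup>2 - fps_X * A * B)"
  proof -
    have "qp 10 10 ^ 4 * (f + 1) * B = qp 10 10 ^ 4 * (f * B + B)"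
      by (simp add: algebra_simps)
    also have "\<dots> = qp 10 10 ^ 4 * (S\<^sup>2 + S * S')"
      by (simp only: fB SS')
    also have "\<dots> = (qp 10 10 ^ 2 * S) * (qp 10 10 ^ 2 * S + qp 10 10 ^ 2 * S')"
      by (simp add: algebra_simps power2_eq_square power4_eq_xxxx)
    also have "\<dots> = 2 * qp 20 20 ^ 4 * (A\<^sup>2 - fps_X * A * B)"
      unfolding S S' by (simp add: algebra_simps power2_eq_square power4_eq_xxxx)
    finally show ?thesis .
  qed
  \<comment> \<open>The infinite product (q^2;q^4) turns psi(q^2) into E_4, and it equals B times
    (q^10;q^20).\<close>
  have psi: "theta 1 4 2 * B * qp 10 10 = qp 4 4 * qp 20 20"
  proof -
    have "theta 1 4 2 * qp 2 4 = qp 8 8 * (qp 2 4 * (qm 2 8 * qm 6 8))"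
      using theta_plus_eq[of 6 4 2 2 8] by (simp add: mult_ac)
    also have "qm 2 8 * qm 6 8 = qm 2 4" using qm_double[of 2 4] by simp
    also have "qp 2 4 * qm 2 4 = qp 4 8" using qp_mult_qm[of 2 4] by simp
    also have "qp 8 8 * qp 4 8 = qp 4 4" using qp_double[of 4 4] by (simp add: mult.commute)
    finally have 1: "theta 1 4 2 * qp 2 4 = qp 4 4" .
    have "qp 2 4 * qp 20 20 = B * qp 10 10"
      unfolding d10(5) using qp_split[of 2 4 5] by (simp add: B_def numeral_eq_Suc mult_ac)
    then have "theta 1 4 2 * B * qp 10 10 = theta 1 4 2 * qp 2 4 * qp 20 20"
      by (simp add: mult_ac)
    then show ?thesis unfolding 1 .
  qed
  have "(2 * qp 20 20 * qp 10 10 * (qp 4 4 * theta 1 4 2) - 2 * fps_X * qp 20 20 ^ 3 * qp 4 4) * B =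
    2 * qp 20 20 * qp 4 4 * (theta 1 4 2 * B * qp 10 10) - 2 * fps_X * qp 20 20 ^ 3 * qp 4 4 * B"
    by (simp add: algebra_simps)
  also have "\<dots> = qp 10 10 ^ 4 * (f + 1) * B"
    unfolding key psi unfolding E4 by (simp add: algebra_simps power2_eq_square power3_eq_cube power4_eq_xxxx)
  finally have "2 * qp 20 20 * qp 10 10 * (qp 4 4 * theta 1 4 2) - 2 * fps_X * qp 20 20 ^ 3 * qp 4 4
    = qp 10 10 ^ 4 * (f + 1)" using B0 by simp
  then show ?thesis by (simp add: algebra_simps)
qed

lemma mod5_part_generating_function:
  fixes f :: "complex fps"
  assumes f: "f = ((qp 1 5 * qp 4 5)\<^sup>2 * (qm 4 10 * qm 6 10)) / ((qp 2 5 * qp 3 5)\<^sup>2 * (qm 2 10 * qm 8 10))"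
  shows "qp 2 2 ^ 3 * mod5_part 2 f = 2 * qp 4 4 * (quintuple 10 4 * theta 1 5 3)"
    and "qp 2 2 ^ 3 * mod5_part 3 f = - (2 * qp 4 4 * (fps_X * quintuple 10 8 * theta 1 5 1))"
proof -
  define K L where "K = qp 2 2" and "L = qp 4 4"
  let ?F = "theta (-1) 6 (-2)" and ?G = "theta 1 4 2"
  have K: "qp 10 10 = dilate K" and L: "qp 20 20 = dilate L"
    using dilate_qpoch[of 2 2] dilate_qpoch[of 4 4] by (simp_all add: K_def L_def)
  have F: "qp 4 4 = ?F"
    using qp_split[of 4 4 3] theta_minus_eq[of 4 6 "-2" 8 12] by (simp add: numeral_eq_Suc mult_ac)
  let ?Y = "dilate L * (dilate L * (dilate L * (fps_X ^ 1 * ?F)))"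
  let ?Z = "dilate L * (dilate K * (?F * ?G))"
  \<comment> \<open>Written with sums only and with nested dilations, the identity can be split by
    \<open>mod5_part_add\<close> and \<open>mod5_part_dilate\<close>.\<close>
  have "dilate K * (dilate K * (dilate K * (dilate K * f))) + (?Y + ?Y)
      + dilate K * (dilate K * (dilate K * (dilate K * 1))) = ?Z + ?Z"
    using generating_function[OF f] unfolding K L F
    by (simp add: algebra_simps power3_eq_cube power4_eq_xxxx)
  note main = this
  have eq: "K ^ 4 * mod5_part r f + 2 * (L ^ 3 * mod5_part r (fps_X ^ 1 * ?F)) + K ^ 4 * mod5_part r 1
      = 2 * (L * K * mod5_part r (?F * ?G))" if "r < 5" for r
    using arg_cong[OF main, of "mod5_part r"] unfolding mod5_part_add mod5_part_dilate[OF that]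
    by (simp add: algebra_simps power3_eq_cube power4_eq_xxxx)
  have one: "mod5_part r 1 = 0" if "r > 0" for r
    using that by (simp add: fps_eq_iff mod5_part_nth)
  \<comment> \<open>Classes 2 and 3 of q E_4 are classes 1 and 2 of E_4, which vanish.\<close>
  have X: "mod5_part 2 (fps_X ^ 1 * ?F) = 0" "mod5_part 3 (fps_X ^ 1 * ?F) = 0"
    using mod5_part_X_power[of 1 2 ?F] mod5_part_X_power[of 1 3 ?F] mod5_part_theta_6_2(2,3) by simp_all
  have K0: "K \<noteq> 0" unfolding K_def by (simp add: qp_nonzero)
  have "K * (K ^ 3 * mod5_part 2 f) = K * (2 * L * (quintuple 10 4 * theta 1 5 3))"
    using eq[of 2] unfolding X one[of 2, simplified] mod5_part_theta_mult
    by (simp add: algebra_simps power3_eq_cube power4_eq_xxxx)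
  then show "qp 2 2 ^ 3 * mod5_part 2 f = 2 * qp 4 4 * (quintuple 10 4 * theta 1 5 3)"
    unfolding K_def L_def by (rule mult_left_cancel[OF K0[unfolded K_def], THEN iffD1])
  have "K * (K ^ 3 * mod5_part 3 f) = K * (- (2 * L * (fps_X * quintuple 10 8 * theta 1 5 1)))"
    using eq[of 3] unfolding X one[of 3, simplified] mod5_part_theta_mult
    by (simp add: algebra_simps power3_eq_cube power4_eq_xxxx)
  then show "qp 2 2 ^ 3 * mod5_part 3 f = - (2 * qp 4 4 * (fps_X * quintuple 10 8 * theta 1 5 1))"
    unfolding K_def L_def by (rule mult_left_cancel[OF K0[unfolded K_def], THEN iffD1])
qed

text \<open>For d = 10 the factor \<open>theta (-1) 30 10\<close> of the quintuple identity is E_20.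
  Doubling a = 4 gives 8, doubling a = 8 gives 16 = 20 - 4, so the pairs 4, 16 and 8, 12 are
  interchanged.\<close>

lemma quintuple_values:
  "quintuple 10 4 * (qp 4 20 * qp 16 20) = qp 20 20 * (qp 8 20 * qp 12 20)"
  "quintuple 10 8 * (qp 8 20 * qp 12 20) = qp 20 20 * (qp 4 20 * qp 16 20)"
proof -
  have 1: "theta (-1) 30 10 = qp 20 20"
    using qp_split[of 20 20 3] theta_minus_eq[of 40 30 10 20 60] by (simp add: numeral_eq_Suc mult_ac)
  have 2: "theta (-1) 10 (-6) = qp 20 20 * (qp 4 20 * qp 16 20)" "theta (-1) 10 6 = qp 20 20 * (qp 4 20 * qp 16 20)"
    "theta (-1) 10 (-2) = qp 20 20 * (qp 8 20 * qp 12 20)"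
    using theta_minus_eq[of 4 10 "-6" 16 20] theta_minus_eq[of 16 10 6 4 20]
      theta_minus_eq[of 8 10 "-2" 12 20] by (simp_all add: mult_ac)
  have "quintuple 10 4 * theta (-1) 10 (-6) = theta (-1) 30 10 * theta (-1) 10 (-2)"
    using quintuple_product[of 4 10] by simp
  then have "qp 20 20 * (quintuple 10 4 * (qp 4 20 * qp 16 20)) = qp 20 20 * (qp 20 20 * (qp 8 20 * qp 12 20))"
    unfolding 1 2 by (simp add: mult_ac)
  then show "quintuple 10 4 * (qp 4 20 * qp 16 20) = qp 20 20 * (qp 8 20 * qp 12 20)"
    by (simp add: qp_nonzero)
  have "quintuple 10 8 * theta (-1) 10 (-2) = theta (-1) 30 10 * theta (-1) 10 6"
    using quintuple_product[of 8 10] by simp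
  then have "qp 20 20 * (quintuple 10 8 * (qp 8 20 * qp 12 20)) = qp 20 20 * (qp 20 20 * (qp 4 20 * qp 16 20))"
    unfolding 1 2 by (simp add: mult_ac)
  then show "quintuple 10 8 * (qp 8 20 * qp 12 20) = qp 20 20 * (qp 4 20 * qp 16 20)"
    by (simp add: qp_nonzero)
qed

theorem theorem4p2:
  fixes \<alpha> :: "nat \<Rightarrow> complex" and q :: "complex fps"
  assumes q: "q = fps_X"
    and alpha: "Abs_fps \<alpha> =
      (qpochs [q, q ^ 4] (q ^ 5) ^ 2 * qpochs [- (q ^ 4), - (q ^ 6)] (q ^ 10)) /
      (qpochs [q ^ 2, q ^ 3] (q ^ 5) ^ 2 * qpochs [- (q ^ 2), - (q ^ 8)] (q ^ 10))"
  shows "Abs_fps (\<lambda>n. \<alpha> (5 * n + 2)) =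
      (2 * RR_G (q ^ 2) ^ 4 * RR_H (q ^ 2) ^ 3 * E_fun (q ^ 20) ^ 2) /
      (RR_G (q ^ 4) * RR_H (q ^ 4) ^ 2 * E_fun (q ^ 10) ^ 2)
    \<and> Abs_fps (\<lambda>n. \<alpha> (5 * n + 3)) =
      - ((2 * q * RR_G (q ^ 2) ^ 3 * RR_H (q ^ 2) ^ 4 * E_fun (q ^ 20) ^ 2) /
         (RR_G (q ^ 4) ^ 2 * RR_H (q ^ 4) * E_fun (q ^ 10) ^ 2))"
proof -
  define f where "f = Abs_fps \<alpha>"
  \<comment> \<open>The reciprocals of G(q^2), H(q^2), G(q^4) and H(q^4).\<close>
  define g2 h2 g4 h4 where "g2 = qp 2 10 * qp 8 10" and "h2 = qp 4 10 * qp 6 10"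
    and "g4 = qp 4 20 * qp 16 20" and "h4 = qp 8 20 * qp 12 20"
  define G2 H2 G4 H4 where "G2 = RR_G (q ^ 2)" and "H2 = RR_H (q ^ 2)"
    and "G4 = RR_G (q ^ 4)" and "H4 = RR_H (q ^ 4)"
  define e10 e20 where "e10 = qp 10 10" and "e20 = qp 20 20"
  have parts: "Abs_fps (\<lambda>n. \<alpha> (5 * n + r)) = mod5_part r f" for r
    by (simp add: f_def fps_eq_iff mod5_part_nth)
  have f: "f = ((qp 1 5 * qp 4 5)\<^sup>2 * (qm 4 10 * qm 6 10)) / ((qp 2 5 * qp 3 5)\<^sup>2 * (qm 2 10 * qm 8 10))"
    using alpha by (simp add: f_def q qpochs_def)
  note U = mod5_part_generating_function[OF f]
  have E: "E_fun (q ^ 20) = e20" "E_fun (q ^ 10) = e10"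
    by (simp_all add: E_fun_def q e10_def e20_def)
  have inv: "G2 = 1 / g2" "H2 = 1 / h2" "G4 = 1 / g4" "H4 = 1 / h4"
    unfolding G2_def H2_def G4_def H4_def RR_G_def RR_H_def qpochs_def g2_def h2_def g4_def h4_def q
    by (simp_all flip: power_mult)
  have nth_0: "g2 $ 0 = 1" "h2 $ 0 = 1" "g4 $ 0 = 1" "h4 $ 0 = 1" "e10 $ 0 = 1"
    by (simp_all add: g2_def h2_def g4_def h4_def e10_def)
  then have ne: "g2 \<noteq> 0" "h2 \<noteq> 0" "g4 \<noteq> 0" "h4 \<noteq> 0" "e10 \<noteq> 0" by auto
  have Gg: "G2 * g2 = 1" "H2 * h2 = 1" "G4 * g4 = 1" "H4 * h4 = 1"
    unfolding inv using nth_0 by (simp_all add: fps_divide_mult_cancel)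
  have "(G4 * g4) $ 0 = 1" "(H4 * h4) $ 0 = 1" unfolding Gg by simp_all
  then have GH0: "G4 $ 0 = 1" "H4 $ 0 = 1" by (simp_all add: nth_0)
  have P22: "qp 2 2 = g2 * h2 * e10"
    using qp_split[of 2 2 5] by (simp add: g2_def h2_def e10_def numeral_eq_Suc mult_ac)
  have P44: "qp 4 4 = g4 * h4 * e20"
    using qp_split[of 4 4 5] by (simp add: g4_def h4_def e20_def numeral_eq_Suc mult_ac)
  have b: "theta 1 5 3 * g2 = e10 * g4"
  proof -
    have "theta 1 5 3 * g2 = e10 * ((qp 2 10 * qm 2 10) * (qp 8 10 * qm 8 10))"
      using theta_plus_eq[of 8 5 3 2 10] by (simp add: g2_def e10_def mult_ac)
    then show ?thesis using qp_mult_qm[of 2 10] qp_mult_qm[of 8 10] by (simp add: g4_def)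
  qed
  have a: "theta 1 5 1 * h2 = e10 * h4"
  proof -
    have "theta 1 5 1 * h2 = e10 * ((qp 4 10 * qm 4 10) * (qp 6 10 * qm 6 10))"
      using theta_plus_eq[of 6 5 1 4 10] by (simp add: h2_def e10_def mult_ac)
    then show ?thesis using qp_mult_qm[of 4 10] qp_mult_qm[of 6 10] by (simp add: h4_def)
  qed
  note e = quintuple_values[folded g4_def h4_def e20_def]
  \<comment> \<open>The extra g2 on the right serves to evaluate \<open>theta 1 5 3\<close>, as the
    g4 from E_4 does for \<open>quintuple 10 4\<close>. One E_10 of E_2^3 is set apart to be
    cancelled.\<close>
  have "e10 * (mod5_part 2 f * (g2 ^ 4 * h2 ^ 3 * e10\<^sup>2)) = g2 * (qp 2 2 ^ 3 * mod5_part 2 f)"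
    unfolding P22 by (simp add: algebra_simps power2_eq_square power3_eq_cube power4_eq_xxxx)
  also have "\<dots> = 2 * h4 * e20 * (quintuple 10 4 * g4) * (theta 1 5 3 * g2)"
    unfolding U P44 by (simp add: mult_ac)
  also have "\<dots> = e10 * (2 * e20\<^sup>2 * (g4 * h4\<^sup>2))"
    unfolding e b by (simp add: power2_eq_square mult_ac)
  finally have U2: "mod5_part 2 f * (g2 ^ 4 * h2 ^ 3 * e10\<^sup>2) = 2 * e20\<^sup>2 * (g4 * h4\<^sup>2)"
    by (rule mult_left_cancel[OF ne(5), THEN iffD1])
  have "e10 * (mod5_part 3 f * (g2 ^ 3 * h2 ^ 4 * e10\<^sup>2)) = h2 * (qp 2 2 ^ 3 * mod5_part 3 f)"
    unfolding P22 by (simp add: algebra_simps power2_eq_square power3_eq_cube power4_eq_xxxx)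
  also have "\<dots> = - (2 * fps_X * g4 * e20 * (quintuple 10 8 * h4) * (theta 1 5 1 * h2))"
    unfolding U P44 by (simp add: mult_ac)
  also have "\<dots> = e10 * (- (2 * fps_X * e20\<^sup>2 * (g4\<^sup>2 * h4)))"
    unfolding e a by (simp add: power2_eq_square mult_ac)
  finally have U3: "mod5_part 3 f * (g2 ^ 3 * h2 ^ 4 * e10\<^sup>2) = - (2 * fps_X * e20\<^sup>2 * (g4\<^sup>2 * h4))"
    by (rule mult_left_cancel[OF ne(5), THEN iffD1])
  have "mod5_part 2 f = (2 * G2 ^ 4 * H2 ^ 3 * e20\<^sup>2) / (G4 * H4\<^sup>2 * e10\<^sup>2)"
  proof (rule fps_eq_divideI)
    show "(G4 * H4\<^sup>2 * e10\<^sup>2) $ 0 \<noteq> 0"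
      by (simp add: power2_eq_square GH0 nth_0)
    \<comment> \<open>A factor 1 is inserted to bring in the powers of g2 and h2 that occur in
      \<open>U2\<close>.\<close>
    have "mod5_part 2 f * (G4 * H4\<^sup>2 * e10\<^sup>2) =
      mod5_part 2 f * (G4 * H4\<^sup>2 * e10\<^sup>2) * ((G2 * g2) ^ 4 * (H2 * h2) ^ 3)"
      unfolding Gg by simp
    also have "\<dots> = G4 * H4\<^sup>2 * G2 ^ 4 * H2 ^ 3 * (mod5_part 2 f * (g2 ^ 4 * h2 ^ 3 * e10\<^sup>2))"
      by (simp add: power_mult_distrib mult_ac)
    also have "\<dots> = 2 * G2 ^ 4 * H2 ^ 3 * e20\<^sup>2 * ((G4 * g4) * (H4 * h4)\<^sup>2)"
      unfolding U2 by (simp add: power_mult_distrib mult_ac)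
    finally show "mod5_part 2 f * (G4 * H4\<^sup>2 * e10\<^sup>2) = 2 * G2 ^ 4 * H2 ^ 3 * e20\<^sup>2"
      unfolding Gg by simp
  qed
  \<comment> \<open>The sign outside the quotient is moved to the left, so that
    \<open>fps_eq_divideI\<close> applies.\<close>
  moreover have neg: "- mod5_part 3 f = (2 * q * G2 ^ 3 * H2 ^ 4 * e20\<^sup>2) / (G4\<^sup>2 * H4 * e10\<^sup>2)"
  proof (rule fps_eq_divideI)
    show "(G4\<^sup>2 * H4 * e10\<^sup>2) $ 0 \<noteq> 0"
      by (simp add: power2_eq_square GH0 nth_0)
    have "- mod5_part 3 f * (G4\<^sup>2 * H4 * e10\<^sup>2) =
      - mod5_part 3 f * (G4\<^sup>2 * H4 * e10\<^sup>2) * ((G2 * g2) ^ 3 * (H2 * h2) ^ 4)"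
      unfolding Gg by simp
    also have "\<dots> = - (G4\<^sup>2 * H4 * G2 ^ 3 * H2 ^ 4 * (mod5_part 3 f * (g2 ^ 3 * h2 ^ 4 * e10\<^sup>2)))"
      by (simp add: power_mult_distrib mult_ac)
    also have "\<dots> = 2 * q * G2 ^ 3 * H2 ^ 4 * e20\<^sup>2 * ((G4 * g4)\<^sup>2 * (H4 * h4))"
      unfolding U3 q by (simp add: power_mult_distrib mult_ac)
    finally show "- mod5_part 3 f * (G4\<^sup>2 * H4 * e10\<^sup>2) = 2 * q * G2 ^ 3 * H2 ^ 4 * e20\<^sup>2"
      unfolding Gg by simp
  qed
  ultimately show ?thesis
    unfolding parts E G2_def[symmetric] H2_def[symmetric] G4_def[symmetric] H4_def[symmetric]
    by (simp only: neg[symmetric] minus_minus)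
qed

end
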